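(* Let $Z=(z_i)_{i=1}^\ell\subset\mathcal{X}$ be a fixed (finite) subset, $s\le\ell$, and let $X=(x_j)_{j=1}^M$ be an $M$-point independent sample from $\mu$. Then $$\mathbb{E}\left[\frac1M\sum_{j=1}^M\left(k^Z(x_j,x_j)-k_{s,X}^Z(x_j,x_j)\right)\right]=\mathbb{E}\left[\frac1M\sum_{j=1}^M\left(k_X^Z(x_j,x_j)-k_{s,X}^Z(x_j,x_j)\right)\right]\le\sum_{i>s}\sigma_i,$$ where the expectation is taken regarding the draws of $X$.
   Context: $\mathcal{X}$ is a Hausdorff space, $\mu$ a (Borel) probability measure on $\mathcal{X}$, and $k:\mathcal{X}\times\mathcal{X}\to\mathbb{R}$ a positive definite kernel (all Gram matrices are positive semi-definite) with $\int_{\mathcal{X}}k(x,x)\,d\mu(x)<\infty$ and reproducing kernel Hilbert space $\mathcal{H}_k$. The integral operator is $\mathcal{K}:L^2(\mu)\to L^2(\mu)$, $(\mathcal{K}f)(x)=\int_{\mathcal{X}}k(x,y)f(y)\,d\mu(y)$, with eigenpairs $(\sigma_i,e_i)_{i=1}^\infty$, $\sigma_1\ge\sigma_2\ge\cdots\ge0$, $(e_i)$ orthonormal in $L^2(\mu)$. Standing assumption: the Mercer decomposition $k(x,y)=\sum_{i=1}^\infty\sigma_i e_i(x)e_i(y)$ holds and $(\sqrt{\sigma_i}e_i)_{i}$ (over indices with $\sigma_i>0$) is an orthonormal basis of $\mathcal{H}_k$. For finite point families $A,B$ write $k(A,B)=(k(a,b))_{a\in A,b\in B}$ (and $k(Z,x)\in\mathbb{R}^\ell$,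 $k(x,Z)=k(Z,x)^\top$); $A^+$ is the Moore–Penrose pseudo-inverse. $k^Z(x,y)=k(x,Z)k(Z,Z)^+k(Z,y)$. For $X=(x_j)_{j=1}^M$ let $h_X(x,y)=\frac1M\sum_{j=1}^Mk(x,x_j)k(x_j,y)$, so $h_X(Z,Z)=\frac1Mk(Z,X)k(X,Z)$. Take $H\in\mathbb{R}^{\ell\times\ell}$ with $H^\top H=h_X(Z,Z)$, decompose $Hk(Z,Z)^+H^\top=V\mathrm{diag}(\kappa_1,\dots,\kappa_\ell)V^\top$ with $V=[v_1,\dots,v_\ell]$ orthogonal, $\kappa_1\ge\cdots\ge\kappa_\ell\ge0$, put $f_i(x)=(H^+v_i)^\top k(Z,x)$, and define $k_X^Z(x,y)=\sum_{i=1}^\ell\kappa_if_i(x)f_i(y)$ and $k_{s,X}^Z(x,y)=\sum_{i=1}^s\kappa_if_i(x)f_i(y)$. *)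

theory Defs
  imports "HOL-Probability.Probability" "Jordan_Normal_Form.Matrix"
begin

section \<open>Kernels and reproducing kernel Hilbert spaces\<close>

definition pd_kernel :: "('a \<Rightarrow> 'a \<Rightarrow> real) \<Rightarrow> bool" where
  "pd_kernel k \<longleftrightarrow>
     (\<forall>x y. k x y = k y x) \<and>
     (\<forall>n (x :: nat \<Rightarrow> 'a) (c :: nat \<Rightarrow> real). 0 \<le> (\<Sum>i<n. \<Sum>j<n. c i * c j * k (x i) (x j)))"

text \<open>A Hilbert space of functions is given by its carrier \<open>F\<close> and its inner product \<open>ip\<close>;
  the values of \<open>ip\<close> outside \<open>F\<close> are irrelevant.\<close>

definition fun_norm :: "(('a \<Rightarrow> real) \<Rightarrow> ('a \<Rightarrow> real) \<Rightarrow> real) \<Rightarrow> ('a \<Rightarrow> real) \<Rightarrow> real" where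
  "fun_norm ip f = sqrt (ip f f)"

locale hilbert_function_space =
  fixes F :: "('a \<Rightarrow> real) set"
    and ip :: "('a \<Rightarrow> real) \<Rightarrow> ('a \<Rightarrow> real) \<Rightarrow> real"
  assumes zero_mem: "(\<lambda>x. 0) \<in> F"
    and add_mem: "f \<in> F \<Longrightarrow> g \<in> F \<Longrightarrow> (\<lambda>x. f x + g x) \<in> F"
    and scale_mem: "f \<in> F \<Longrightarrow> (\<lambda>x. c * f x) \<in> F"
    and ip_sym: "f \<in> F \<Longrightarrow> g \<in> F \<Longrightarrow> ip f g = ip g f"
    and ip_add: "f \<in> F \<Longrightarrow> g \<in> F \<Longrightarrow> h \<in> F \<Longrightarrow> ip (\<lambda>x. f x + g x) h = ip f h + ip g h"
    and ip_scale: "f \<in> F \<Longrightarrow> g \<in> F \<Longrightarrow> ip (\<lambda>x. c * f x) g = c * ip f g"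
    and ip_nonneg: "f \<in> F \<Longrightarrow> 0 \<le> ip f f"
    and ip_definite: "f \<in> F \<Longrightarrow> ip f f = 0 \<Longrightarrow> f = (\<lambda>x. 0)"
    and complete: "(\<And>n. u n \<in> F) \<Longrightarrow>
        (\<And>\<epsilon>. 0 < \<epsilon> \<Longrightarrow> \<exists>N. \<forall>m\<ge>N. \<forall>n\<ge>N. fun_norm ip (\<lambda>x. u m x - u n x) < \<epsilon>) \<Longrightarrow>
        \<exists>f\<in>F. (\<lambda>n. fun_norm ip (\<lambda>x. u n x - f x)) \<longlonglongrightarrow> 0"

locale rkhs = hilbert_function_space F ip
  for k :: "'a \<Rightarrow> 'a \<Rightarrow> real"
    and F :: "('a \<Rightarrow> real) set"
    and ip :: "('a \<Rightarrow> real) \<Rightarrow> ('a \<Rightarrow> real) \<Rightarrow> real" +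
  assumes kernel_mem: "k x \<in> F"
    and reproducing: "f \<in> F \<Longrightarrow> ip f (k x) = f x"

definition orthonormal_basis_of ::
  "('a \<Rightarrow> real) set \<Rightarrow> (('a \<Rightarrow> real) \<Rightarrow> ('a \<Rightarrow> real) \<Rightarrow> real) \<Rightarrow> 'i set \<Rightarrow> ('i \<Rightarrow> 'a \<Rightarrow> real) \<Rightarrow> bool" where
  "orthonormal_basis_of F ip I b \<longleftrightarrow>
     (\<forall>i\<in>I. b i \<in> F) \<and>
     (\<forall>i\<in>I. \<forall>j\<in>I. ip (b i) (b j) = (if i = j then 1 else 0)) \<and>
     (\<forall>f\<in>F. \<forall>\<epsilon>>0. \<exists>J c. finite J \<and> J \<subseteq> I \<and> fun_norm ip (\<lambda>x. f x - (\<Sum>i\<in>J. c i * b i x)) < \<epsilon>)"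

section \<open>The integral operator on \<open>L\<^sup>2(\<mu>)\<close>\<close>

text \<open>Elements of \<open>L\<^sup>2(\<mu>)\<close> are represented by everywhere defined functions.\<close>

definition L2_functions :: "'a measure \<Rightarrow> ('a \<Rightarrow> real) set" where
  "L2_functions \<mu> = {f. f \<in> borel_measurable \<mu> \<and> integrable \<mu> (\<lambda>x. (f x)\<^sup>2)}"

definition integral_operator ::
  "'a measure \<Rightarrow> ('a \<Rightarrow> 'a \<Rightarrow> real) \<Rightarrow> ('a \<Rightarrow> real) \<Rightarrow> 'a \<Rightarrow> real" where
  "integral_operator \<mu> k f x = (\<integral>y. k x y * f y \<partial>\<mu>)"

definition L2_orthonormal :: "'a measure \<Rightarrow> (nat \<Rightarrow> 'a \<Rightarrow> real) \<Rightarrow> bool" where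
  "L2_orthonormal \<mu> e \<longleftrightarrow>
     (\<forall>i. e i \<in> L2_functions \<mu>) \<and>
     (\<forall>i j. (\<integral>x. e i x * e j x \<partial>\<mu>) = (if i = j then 1 else 0))"

section \<open>The low-rank kernels\<close>

text \<open>The Moore--Penrose pseudo-inverse of a real matrix, by the four Penrose conditions.\<close>

definition is_pinv :: "real mat \<Rightarrow> real mat \<Rightarrow> bool" where
  "is_pinv A B \<longleftrightarrow>
     B \<in> carrier_mat (dim_col A) (dim_row A) \<and>
     A * B * A = A \<and> B * A * B = B \<and>
     transpose_mat (A * B) = A * B \<and> transpose_mat (B * A) = B * A"

definition pinv :: "real mat \<Rightarrow> real mat" where
  "pinv A = (THE B. is_pinv A B)"

text \<open>Finite point families are lists, possibly with repeated points; all indices start at 0.\<close>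

definition kernel_mat :: "('a \<Rightarrow> 'a \<Rightarrow> real) \<Rightarrow> 'a list \<Rightarrow> 'a list \<Rightarrow> real mat" where
  "kernel_mat k A B = Matrix.mat (length A) (length B) (\<lambda>(i, j). k (A ! i) (B ! j))"

definition kernel_vec :: "('a \<Rightarrow> 'a \<Rightarrow> real) \<Rightarrow> 'a list \<Rightarrow> 'a \<Rightarrow> real Matrix.vec" where
  "kernel_vec k A x = Matrix.vec (length A) (\<lambda>i. k (A ! i) x)"

definition nystrom_kernel :: "('a \<Rightarrow> 'a \<Rightarrow> real) \<Rightarrow> 'a list \<Rightarrow> 'a \<Rightarrow> 'a \<Rightarrow> real" where
  "nystrom_kernel k Z x y =
     scalar_prod (kernel_vec k Z x) (pinv (kernel_mat k Z Z) *\<^sub>v kernel_vec k Z y)"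

definition h_kernel :: "('a \<Rightarrow> 'a \<Rightarrow> real) \<Rightarrow> 'a list \<Rightarrow> 'a \<Rightarrow> 'a \<Rightarrow> real" where
  "h_kernel k X x y = (1 / real (length X)) * (\<Sum>j<length X. k x (X ! j) * k (X ! j) y)"

text \<open>\<open>H\<close>, \<open>V\<close> and \<open>\<kappa>\<close> are not uniquely determined; the following predicate says that they are an
  admissible choice for the points \<open>Z\<close> and the sample \<open>X\<close>.\<close>

definition nystrom_decomposition ::
  "('a \<Rightarrow> 'a \<Rightarrow> real) \<Rightarrow> 'a list \<Rightarrow> 'a list \<Rightarrow> real mat \<Rightarrow> real mat \<Rightarrow> (nat \<Rightarrow> real) \<Rightarrow> bool" where
  "nystrom_decomposition k Z X H V \<kappa> \<longleftrightarrow>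
     (let l = length Z in
       H \<in> carrier_mat l l \<and>
       transpose_mat H * H = kernel_mat (h_kernel k X) Z Z \<and>
       V \<in> carrier_mat l l \<and>
       transpose_mat V * V = 1\<^sub>m l \<and> V * transpose_mat V = 1\<^sub>m l \<and>
       H * pinv (kernel_mat k Z Z) * transpose_mat H = V * mat_diag l \<kappa> * transpose_mat V \<and>
       (\<forall>i j. i \<le> j \<longrightarrow> j < l \<longrightarrow> \<kappa> j \<le> \<kappa> i) \<and> (\<forall>i<l. 0 \<le> \<kappa> i))"

definition nystrom_feature ::
  "('a \<Rightarrow> 'a \<Rightarrow> real) \<Rightarrow> 'a list \<Rightarrow> real mat \<Rightarrow> real mat \<Rightarrow> nat \<Rightarrow> 'a \<Rightarrow> real" where
  "nystrom_feature k Z H V i x = scalar_prod (pinv H *\<^sub>v col V i) (kernel_vec k Z x)"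

definition truncated_nystrom_kernel ::
  "('a \<Rightarrow> 'a \<Rightarrow> real) \<Rightarrow> 'a list \<Rightarrow> real mat \<Rightarrow> real mat \<Rightarrow> (nat \<Rightarrow> real) \<Rightarrow> nat \<Rightarrow> 'a \<Rightarrow> 'a \<Rightarrow> real" where
  "truncated_nystrom_kernel k Z H V \<kappa> s x y =
     (\<Sum>i<s. \<kappa> i * nystrom_feature k Z H V i x * nystrom_feature k Z H V i y)"

definition projected_nystrom_kernel ::
  "('a \<Rightarrow> 'a \<Rightarrow> real) \<Rightarrow> 'a list \<Rightarrow> real mat \<Rightarrow> real mat \<Rightarrow> (nat \<Rightarrow> real) \<Rightarrow> 'a \<Rightarrow> 'a \<Rightarrow> real" where
  "projected_nystrom_kernel k Z H V \<kappa> x y =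
     (\<Sum>i<length Z. \<kappa> i * nystrom_feature k Z H V i x * nystrom_feature k Z H V i y)"

end

theory Submission
  imports Defs
begin

text \<open>Write \<open>K = k(Z,Z)\<close>, \<open>W = K\<^sup>+\<close>, and let \<open>p i\<close> be the vector \<open>H\<^sup>T v\<^sub>i\<close>. The \<open>p i\<close> are orthogonal for the
  semi-inner product given by \<open>W\<close>, with squared lengths \<open>\<kappa> i\<close>, and have the same second moments as the
  vectors \<open>k(Z,x\<^sub>j)\<close> averaged over the sample. Moreover \<open>\<kappa> i\<close> times the sample mean of \<open>f\<^sub>i\<^sup>2\<close> is
  \<open>\<kappa> i\<close>. Hence both random variables are equal to \<open>T = (\<Sum>i=s..<l. \<kappa> i)\<close> pointwise.

  By Ky Fan's principle \<open>T\<close> is the least mean squared distance, in the \<open>W\<close>-seminorm, of the vectors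
  \<open>k(Z,x\<^sub>j)\<close> from a subspace of dimension at most \<open>s\<close>. This gives measurability of \<open>T\<close>, although nothing
  is assumed about measurability of \<open>H\<close>, \<open>V\<close>, \<open>\<kappa>\<close>: an infimum of continuous functions of the sample
  vectors is upper semicontinuous. It also gives the bound, by comparison with the fixed span of the
  vectors \<open>e i (Z)\<close>, \<open>i < s\<close>: the squared distance of \<open>k(Z,y)\<close> from it is at most the Mercer remainder
  \<open>k y y - (\<Sum>i<s. \<sigma> i * (e i y)\<^sup>2)\<close>, whose integral is the tail of the eigenvalue series.\<close>

section \<open>Semi-inner products\<close>

text \<open>The form may be degenerate: the Gram matrix can be singular, and a matrix form ignores
  all coordinates beyond its dimension.\<close>

locale psd_form =
  fixes B :: "('i \<Rightarrow> real) \<Rightarrow> ('i \<Rightarrow> real) \<Rightarrow> real"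
  assumes sym: "B u v = B v u"
    and add: "B (\<lambda>x. u x + v x) w = B u w + B v w"
    and scale: "B (\<lambda>x. c * u x) w = c * B u w"
    and nonneg: "0 \<le> B u u"
begin

lemma add_right: "B w (\<lambda>x. u x + v x) = B w u + B w v"
  by (metis add sym)

lemma scale_right: "B w (\<lambda>x. c * u x) = c * B w u"
  by (metis scale sym)

lemma zero: "B (\<lambda>x. 0) v = 0"
  using scale[of 0 "\<lambda>x. 0" v] by simp

lemma diff: "B (\<lambda>x. u x - v x) w = B u w - B v w"
  using add[of u "\<lambda>x. (- 1) * v x" w] scale[of "- 1" v w] by simp

lemma diff_right: "B w (\<lambda>x. u x - v x) = B w u - B w v"
  by (metis diff sym)

lemma sum_left: "B (\<lambda>x. \<Sum>i\<in>I. c i * w i x) v = (\<Sum>i\<in>I. c i * B (w i) v)"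
  by (induction I rule: infinite_finite_induct) (simp_all add: zero add scale)

text \<open>The degenerate case of Cauchy-Schwarz; below it stands in for definiteness.\<close>

lemma null:
  assumes "B u u = 0"
  shows "B u v = 0"
proof (rule ccontr)
  assume *: "B u v \<noteq> 0"
  \<comment> \<open>With \<open>B u u = 0\<close> the quadratic in \<open>t\<close> is affine with
    slope \<open>2 * B u v\<close>; this \<open>t\<close> brings its value down to -1.\<close>
  define t where "t = - (B v v + 1) / (2 * B u v)"
  have "0 \<le> B (\<lambda>x. v x + t * u x) (\<lambda>x. v x + t * u x)"
    by (rule nonneg)
  also have "\<dots> = B v v + 2 * t * B u v"
    using assms by (simp add: add scale add_right scale_right sym[of v u])
  also have "\<dots> = - 1"
    using * by (simp add: t_def field_simps)
  finally show False by simp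
qed

text \<open>Lengths at most one, instead of orthonormality, admit zero vectors. So a system of
  exactly \<open>n\<close> vectors exists however degenerate the form is, and stands for a subspace
  of dimension at most \<open>n\<close>.\<close>

definition contractive_system :: "(nat \<Rightarrow> 'i \<Rightarrow> real) \<Rightarrow> nat \<Rightarrow> bool" where
  "contractive_system q n \<longleftrightarrow>
     (\<forall>a<n. \<forall>b<n. a \<noteq> b \<longrightarrow> B (q a) (q b) = 0) \<and> (\<forall>a<n. B (q a) (q a) \<le> 1)"

text \<open>The form left after removing the components along \<open>q\<close>. If all lengths are 0
  or 1, its value at a vector paired with itself is the squared seminorm distance from the span of
  \<open>q\<close>.\<close>

definition residual :: "(nat \<Rightarrow> 'i \<Rightarrow> real) \<Rightarrow> nat \<Rightarrow> ('i \<Rightarrow> real) \<Rightarrow> ('i \<Rightarrow> real) \<Rightarrow> real" where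
  "residual q n u v = B u v - (\<Sum>a<n. B u (q a) * B v (q a))"

section \<open>Bessel's inequality, residuals and orthonormalisation\<close>

lemma bessel:
  assumes "contractive_system q n"
  shows "(\<Sum>a<n. (B v (q a))\<^sup>2) \<le> B v v"
proof -
  let ?u = "\<lambda>x. \<Sum>a<n. B v (q a) * q a x"
  have uv: "B ?u v = (\<Sum>a<n. (B v (q a))\<^sup>2)"
    by (simp add: sum_left sym[of _ v] power2_eq_square)
  have "B (q a) ?u = B v (q a) * B (q a) (q a)" if "a < n" for a
  proof -
    have "B (q a) ?u = (\<Sum>b<n. B v (q b) * B (q b) (q a))"
      by (subst sym) (rule sum_left)
    also have "\<dots> = (\<Sum>b<n. if b = a then B v (q a) * B (q a) (q a) else 0)"
      by (rule sum.cong) (use assms that in \<open>auto simp: contractive_system_def\<close>)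
    finally show ?thesis using that by simp
  qed
  then have "B ?u ?u = (\<Sum>a<n. (B v (q a))\<^sup>2 * B (q a) (q a))"
    by (subst sum_left) (simp add: power2_eq_square algebra_simps)
  also have "\<dots> \<le> (\<Sum>a<n. (B v (q a))\<^sup>2 * 1)"
    by (intro sum_mono mult_left_mono) (use assms in \<open>auto simp: contractive_system_def\<close>)
  finally have uu: "B ?u ?u \<le> (\<Sum>a<n. (B v (q a))\<^sup>2)" by simp
  \<comment> \<open>With \<open>S\<close> for the sum, \<open>B ?u v = S\<close> and
    \<open>B ?u ?u\<close> is at most \<open>S\<close>, so the square is at most
    \<open>B v v - S\<close>.\<close>
  have "0 \<le> B (\<lambda>x. v x - ?u x) (\<lambda>x. v x - ?u x)" by (rule nonneg)
  also have "\<dots> = B v v - 2 * B ?u v + B ?u ?u"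
    by (simp only: diff diff_right sym[of v ?u])
  finally show ?thesis using uv uu by simp
qed

text \<open>Bessel's inequality is the nonnegativity of this form; it makes \<open>null\<close>
  available for residuals.\<close>

lemma psd_form_residual:
  assumes "contractive_system q n"
  shows "psd_form (residual q n)"
proof
  fix u v w :: "'i \<Rightarrow> real" and c :: real
  show "residual q n u v = residual q n v u"
    by (simp add: residual_def sym[of u v] mult.commute)
  show "residual q n (\<lambda>x. u x + v x) w = residual q n u w + residual q n v w"
    by (simp add: residual_def add distrib_right sum.distrib)
  show "residual q n (\<lambda>x. c * u x) w = c * residual q n u w"
    by (simp add: residual_def scale sum_distrib_left right_diff_distrib mult.assoc)
  show "0 \<le> residual q n u u"
    using bessel[OF assms, of u] by (simp add: residual_def power2_eq_square)
qed

lemma residual_null: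
  assumes "contractive_system q n" "residual q n u u = 0"
  shows "residual q n u v = 0"
proof -
  interpret R: psd_form "residual q n" by (rule psd_form_residual[OF assms(1)])
  show ?thesis by (rule R.null[OF assms(2)])
qed

text \<open>Vectors of residual zero are orthogonal to everything in the residual form, so
  subtracting a combination of them does not change the residual of \<open>v\<close>; and residuals
  never exceed \<open>B\<close>.\<close>

lemma residual_le_distance:
  assumes q: "contractive_system q n" and w: "\<And>i. i \<in> I \<Longrightarrow> residual q n (w i) (w i) = 0"
  shows "residual q n v v \<le> B (\<lambda>x. v x - (\<Sum>i\<in>I. c i * w i x)) (\<lambda>x. v x - (\<Sum>i\<in>I. c i * w i x))"
proof -
  interpret R: psd_form "residual q n" by (rule psd_form_residual[OF q])
  let ?u = "\<lambda>x. \<Sum>i\<in>I. c i * w i x"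
  have null: "residual q n ?u y = 0" for y
    using w by (simp add: R.sum_left residual_null[OF q])
  have "residual q n v v = residual q n (\<lambda>x. v x - ?u x) (\<lambda>x. v x - ?u x)"
    using null[of v] null[of ?u] R.sym[of v ?u] by (simp only: R.diff R.diff_right)
  also have "\<dots> \<le> B (\<lambda>x. v x - ?u x) (\<lambda>x. v x - ?u x)"
    unfolding residual_def by (simp add: sum_nonneg)
  finally show ?thesis .
qed

text \<open>The last conjunct says that each \<open>w i\<close> lies in the span of \<open>q\<close>
  up to seminorm zero. The coefficients \<open>Y\<close> are recorded for building generalised
  inverses. Lengths exactly 0 or 1 keep the induction going.\<close>

lemma gram_schmidt:
  "\<exists>q Y. (\<forall>a<n. q a = (\<lambda>x. \<Sum>i<n. Y a i * w i x)) \<and> contractive_system q n \<and>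
     (\<forall>a<n. B (q a) (q a) = 0 \<or> B (q a) (q a) = 1) \<and> (\<forall>i<n. residual q n (w i) (w i) = 0)"
proof (induction n)
  case 0
  show ?case by (simp add: contractive_system_def)
next
  case (Suc n)
  then obtain q Y where Y: "\<And>a. a < n \<Longrightarrow> q a = (\<lambda>x. \<Sum>i<n. Y a i * w i x)"
    and q: "contractive_system q n"
    and q01: "\<And>a. a < n \<Longrightarrow> B (q a) (q a) = 0 \<or> B (q a) (q a) = 1"
    and res: "\<And>i. i < n \<Longrightarrow> residual q n (w i) (w i) = 0"
    by blast
  define u where "u = (\<lambda>x. w n x - (\<Sum>a<n. B (w n) (q a) * q a x))"
  have uq: "B u (q b) = 0" if "b < n" for b
  proof -
    have "B u (q b) = B (w n) (q b) - (\<Sum>a<n. B (w n) (q a) * B (q a) (q b))"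
      by (simp add: u_def diff sum_left)
    also have "(\<Sum>a<n. B (w n) (q a) * B (q a) (q b)) =
        (\<Sum>a<n. if a = b then B (w n) (q b) * B (q b) (q b) else 0)"
      by (rule sum.cong) (use q that in \<open>auto simp: contractive_system_def\<close>)
    also have "\<dots> = B (w n) (q b) * B (q b) (q b)" using that by simp
    \<comment> \<open>The value is \<open>B (w n) (q b) * (1 - B (q b) (q b))\<close>: the second
      factor vanishes for length one, the first, by \<open>null\<close>, for length zero.\<close>
    finally show ?thesis
      using q01[OF that] null[of "q b" "w n"] sym[of "q b" "w n"] by auto
  qed
  have uq': "B (q b) u = 0" if "b < n" for b using uq[OF that] by (simp only: sym)
  have uw: "B (w n) u = B u u"
  proof -
    have "B u u = B (w n) u - (\<Sum>a<n. B (w n) (q a) * B (q a) u)"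
      by (subst (1) u_def) (simp only: diff sum_left)
    then show ?thesis using uq' by simp
  qed
  have resn: "residual q n (w n) (w n) = B u u"
  proof -
    have "B u u = B u (w n)" using uw sym by metis
    also have "\<dots> = residual q n (w n) (w n)"
      by (simp add: u_def diff sum_left residual_def sym[of "q _" "w n"])
    finally show ?thesis by simp
  qed
  \<comment> \<open>A new direction of seminorm zero is replaced by the zero vector.\<close>
  define \<gamma> where "\<gamma> = (if B u u = 0 then 0 else 1 / sqrt (B u u))"
  have \<gamma>: "\<gamma>\<^sup>2 * B u u = (if B u u = 0 then 0 else 1)"
    using nonneg[of u] by (auto simp: \<gamma>_def power_divide)
  define q' where "q' = q(n := (\<lambda>x. \<gamma> * u x))"
  \<comment> \<open>The last row substitutes the expansions of the earlier \<open>q b\<close> into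
    \<open>u\<close>; earlier rows get a zero in the new column.\<close>
  define Y' where "Y' = (\<lambda>a i. if a < n then (if i < n then Y a i else 0)
     else \<gamma> * (if i < n then - (\<Sum>b<n. B (w n) (q b) * Y b i) else 1))"
  have "q' a = (\<lambda>x. \<Sum>i<Suc n. Y' a i * w i x)" if "a < Suc n" for a
  proof (cases "a < n")
    case True
    then show ?thesis by (simp add: q'_def Y'_def Y)
  next
    case False
    then have [simp]: "a = n" using that by simp
    have "(\<Sum>b<n. B (w n) (q b) * q b x) = (\<Sum>i<n. (\<Sum>b<n. B (w n) (q b) * Y b i) * w i x)" for x
    proof -
      have "(\<Sum>b<n. B (w n) (q b) * q b x) = (\<Sum>b<n. \<Sum>i<n. B (w n) (q b) * (Y b i * w i x))"
        by (rule sum.cong) (auto simp: Y sum_distrib_left)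
      also have "\<dots> = (\<Sum>i<n. (\<Sum>b<n. B (w n) (q b) * Y b i) * w i x)"
        by (subst sum.swap) (simp add: sum_distrib_right mult.assoc)
      finally show ?thesis .
    qed
    then show ?thesis
      by (auto simp: q'_def Y'_def u_def sum_distrib_left algebra_simps sum_negf intro!: ext)
  qed
  moreover have q': "contractive_system q' (Suc n)"
  proof -
    have "B (\<lambda>x. \<gamma> * u x) (\<lambda>x. \<gamma> * u x) \<le> 1"
      using \<gamma> by (auto simp: scale scale_right power2_eq_square mult.assoc split: if_splits)
    then show ?thesis using q
      by (auto simp: contractive_system_def q'_def less_Suc_eq scale scale_right uq uq')
  qed
  moreover have "B (q' a) (q' a) = 0 \<or> B (q' a) (q' a) = 1" if "a < Suc n" for a
    using that \<gamma> q01
    by (auto simp: q'_def less_Suc_eq scale scale_right power2_eq_square mult.assoc split: if_splits)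
  moreover have "residual q' (Suc n) (w i) (w i) = 0" if "i < Suc n" for i
  proof -
    \<comment> \<open>Appending a vector subtracts a square. For \<open>i = n\<close> it removes
      exactly \<open>B u u\<close>; for \<open>i < n\<close> the residual is already zero and cannot
      become negative, so it stays zero.\<close>
    have eq: "residual q' (Suc n) (w i) (w i) = residual q n (w i) (w i) - \<gamma>\<^sup>2 * (B (w i) u)\<^sup>2"
      by (simp add: residual_def q'_def scale_right power2_eq_square)
    show ?thesis
    proof (cases "i = n")
      case True
      then show ?thesis using eq \<gamma> resn uw
        by (auto simp: power2_eq_square split: if_splits)
    next
      case False
      then have "residual q n (w i) (w i) = 0" using res that by simp
      moreover have "0 \<le> residual q' (Suc n) (w i) (w i)"
        by (rule psd_form.nonneg[OF psd_form_residual[OF q']])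
      moreover have "0 \<le> \<gamma>\<^sup>2 * (B (w i) u)\<^sup>2" by simp
      ultimately show ?thesis using eq by linarith
    qed
  qed
  ultimately show ?case by blast
qed

text \<open>The share \<open>\<tau> i\<close> of \<open>\<kappa> i\<close> captured by
  \<open>q\<close> lies between 0 and 1 by Bessel's inequality for \<open>q\<close>, and the shares
  add up to at most \<open>s\<close> by Bessel's inequality for the normalised \<open>p i\<close>.
  With decreasing weights the captured total is largest when the first \<open>s\<close> shares are
  1.\<close>

lemma ky_fan:
  assumes p: "\<And>i j. i < l \<Longrightarrow> j < l \<Longrightarrow> B (p i) (p j) = (if i = j then \<kappa> i else 0)"
    and dec: "\<And>i j. i \<le> j \<Longrightarrow> j < l \<Longrightarrow> \<kappa> j \<le> \<kappa> i"
    and q: "contractive_system q s" and "s \<le> l"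
  shows "(\<Sum>a<s. \<Sum>i<l. (B (q a) (p i))\<^sup>2) \<le> (\<Sum>i<s. \<kappa> i)"
proof -
  have \<kappa>0: "0 \<le> \<kappa> i" if "i < l" for i using p[OF that that] nonneg[of "p i"] by simp
  \<comment> \<open>For \<open>\<kappa> i = 0\<close> division by zero gives share 0, which is
    consistent: then \<open>p i\<close> is orthogonal to everything by \<open>null\<close>.\<close>
  define \<tau> where "\<tau> = (\<lambda>i. \<Sum>a<s. (B (q a) (p i))\<^sup>2 / \<kappa> i)"
  have null: "B v (p i) = 0" if "i < l" "\<kappa> i = 0" for v i
    using null[of "p i" v] p[OF that(1) that(1)] that sym by simp
  have \<kappa>\<tau>: "(\<Sum>a<s. (B (q a) (p i))\<^sup>2) = \<kappa> i * \<tau> i" if "i < l" for i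
    using null[OF that] by (cases "\<kappa> i = 0") (auto simp: \<tau>_def sum_distrib_left)
  have \<tau>1: "\<tau> i \<le> 1" if "i < l" for i
  proof (cases "\<kappa> i = 0")
    case False
    have "\<kappa> i * \<tau> i \<le> \<kappa> i"
      using bessel[OF q, of "p i"] p[OF that that] \<kappa>\<tau>[OF that] by (simp add: sym[of "p i" "q _"])
    then show ?thesis using False \<kappa>0[OF that] by simp
  qed (simp add: \<tau>_def)
  have \<tau>0: "0 \<le> \<tau> i" if "i < l" for i
    using \<kappa>0[OF that] by (simp add: \<tau>_def sum_nonneg)
  define n where "n = (\<lambda>i x. (1 / sqrt (\<kappa> i)) * p i x)"
  have n: "B v (n i) = B v (p i) / sqrt (\<kappa> i)" for v i
    unfolding n_def scale_right by simp
  have n': "B (n i) v = B (p i) v / sqrt (\<kappa> i)" for v i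
    unfolding n_def scale by simp
  have "contractive_system n l"
    unfolding contractive_system_def
  proof (intro conjI allI impI)
    show "B (n i) (n j) = 0" if "i < l" "j < l" "i \<noteq> j" for i j
      by (simp only: n n') (simp add: p that)
    show "B (n i) (n i) \<le> 1" if "i < l" for i
      by (simp only: n n') (simp add: p that \<kappa>0)
  qed
  have "(\<Sum>i<l. (B (q a) (p i))\<^sup>2 / \<kappa> i) \<le> 1" if "a < s" for a
  proof -
    have "(\<Sum>i<l. (B (q a) (p i))\<^sup>2 / \<kappa> i) = (\<Sum>i<l. (B (q a) (n i))\<^sup>2)"
      using \<kappa>0 by (simp add: n power_divide)
    also have "\<dots> \<le> B (q a) (q a)"
      by (rule bessel) fact
    also have "\<dots> \<le> 1" using q that by (simp add: contractive_system_def)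
    finally show ?thesis .
  qed
  then have "(\<Sum>a<s. \<Sum>i<l. (B (q a) (p i))\<^sup>2 / \<kappa> i) \<le> (\<Sum>a<s. 1)"
    by (intro sum_mono) auto
  then have \<tau>s: "(\<Sum>i<l. \<tau> i) \<le> real s"
    unfolding \<tau>_def by (subst sum.swap) simp
  \<comment> \<open>A threshold between the weights: \<open>\<kappa> i\<close> is at least
    \<open>c\<close> below \<open>s\<close> and at most \<open>c\<close> from \<open>s\<close> on.
    For \<open>s = l\<close> nothing is known about \<open>\<kappa> s\<close>, and 0 serves.\<close>
  define c where "c = (if s < l then \<kappa> s else 0)"
  have split: "(\<Sum>i<l. g i) = (\<Sum>i<s. g i) + (\<Sum>i=s..<l. g i)" for g :: "nat \<Rightarrow> real"
    using \<open>s \<le> l\<close> sum.atLeastLessThan_concat[of 0 s l g] by (simp add: atLeast0LessThan)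
  have "(\<Sum>i<s. \<kappa> i * (1 - \<tau> i)) \<ge> (\<Sum>i<s. c * (1 - \<tau> i))"
    using \<tau>1 \<open>s \<le> l\<close> dec \<kappa>0 by (intro sum_mono mult_right_mono) (auto simp: c_def)
  moreover have "(\<Sum>i=s..<l. \<kappa> i * \<tau> i) \<le> (\<Sum>i=s..<l. c * \<tau> i)"
    using \<tau>0 dec by (intro sum_mono mult_right_mono) (auto simp: c_def)
  \<comment> \<open>The share missing below \<open>s\<close> is at least the share spent beyond
    \<open>s\<close>, because all shares add up to at most \<open>s\<close>.\<close>
  moreover have "(\<Sum>i<s. c * (1 - \<tau> i)) - (\<Sum>i=s..<l. c * \<tau> i) = c * (real s - (\<Sum>i<l. \<tau> i))"
    by (simp add: split sum_distrib_left[symmetric] sum_subtractf algebra_simps)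
  moreover have "0 \<le> c * (real s - (\<Sum>i<l. \<tau> i))"
    using \<tau>s \<kappa>0 by (auto simp: c_def)
  moreover have "(\<Sum>i<l. \<kappa> i * \<tau> i) =
      (\<Sum>i<s. \<kappa> i) - (\<Sum>i<s. \<kappa> i * (1 - \<tau> i)) + (\<Sum>i=s..<l. \<kappa> i * \<tau> i)"
    by (simp add: split right_diff_distrib sum_subtractf)
  ultimately have "(\<Sum>i<l. \<kappa> i * \<tau> i) \<le> (\<Sum>i<s. \<kappa> i)"
    by linarith
  then show ?thesis
    by (subst sum.swap) (simp add: \<kappa>\<tau>)
qed

text \<open>The first \<open>s\<close> vectors \<open>p a\<close>, normalised, are optimal;
  \<open>1 / sqrt 0 = 0\<close> turns those with \<open>\<kappa> a = 0\<close> into zero vectors,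
  which a contractive system admits.\<close>

lemma ky_fan_attained:
  assumes p: "\<And>i j. i < l \<Longrightarrow> j < l \<Longrightarrow> B (p i) (p j) = (if i = j then \<kappa> i else 0)"
    and "s \<le> l"
  obtains q where "contractive_system q s" "(\<Sum>a<s. \<Sum>i<l. (B (q a) (p i))\<^sup>2) = (\<Sum>i<s. \<kappa> i)"
proof -
  have \<kappa>0: "0 \<le> \<kappa> i" if "i < l" for i using p[OF that that] nonneg[of "p i"] by simp
  define q where "q = (\<lambda>a x. (1 / sqrt (\<kappa> a)) * p a x)"
  have q: "B (q a) v = B (p a) v / sqrt (\<kappa> a)" "B v (q a) = B v (p a) / sqrt (\<kappa> a)" for v a
    unfolding q_def scale scale_right by simp_all
  have "contractive_system q s"
    unfolding contractive_system_def
  proof (intro conjI allI impI)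
    show "B (q i) (q j) = 0" if "i < s" "j < s" "i \<noteq> j" for i j
      using that \<open>s \<le> l\<close> by (simp only: q) (simp add: p)
    show "B (q i) (q i) \<le> 1" if "i < s" for i
      using that \<open>s \<le> l\<close> by (simp only: q) (simp add: p \<kappa>0)
  qed
  moreover have "(\<Sum>i<l. (B (q a) (p i))\<^sup>2) = \<kappa> a" if "a < s" for a
  proof -
    have "(B (q a) (p i))\<^sup>2 = (if i = a then \<kappa> a else 0)" if "i < l" for i
      using that \<open>a < s\<close> \<open>s \<le> l\<close> by (simp add: q p \<kappa>0 power_divide power2_eq_square)
    then have "(\<Sum>i<l. (B (q a) (p i))\<^sup>2) = (\<Sum>i<l. if i = a then \<kappa> a else 0)"
      by simp
    then show ?thesis using that \<open>s \<le> l\<close> by simp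
  qed
  then have "(\<Sum>a<s. \<Sum>i<l. (B (q a) (p i))\<^sup>2) = (\<Sum>i<s. \<kappa> i)" by simp
  ultimately show ?thesis by (rule that)
qed

end

section \<open>The Moore--Penrose pseudo-inverse\<close>

lemma mult_mat_entry:
  fixes A B :: "real mat"
  assumes "A \<in> carrier_mat n m" "B \<in> carrier_mat m p" "i < n" "j < p"
  shows "(A * B) $$ (i, j) = (\<Sum>k<m. A $$ (i, k) * B $$ (k, j))"
  using assms by (simp add: scalar_prod_def atLeast0LessThan)

text \<open>\<open>A * B\<close> and \<open>A * C\<close> are both the orthogonal projection onto
  the column space of \<open>A\<close>, and \<open>B * A\<close> and \<open>C * A\<close> both the
  one onto its row space. Hence \<open>B = B * A * B = B * A * C = C * A * C = C\<close>.\<close>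

lemma is_pinv_unique:
  assumes B: "is_pinv A B" and C: "is_pinv A C"
  shows "B = C"
proof -
  define n m where "n = dim_row A" and "m = dim_col A"
  have cA [simp]: "A \<in> carrier_mat n m" by (simp add: n_def m_def)
  have cB [simp]: "B \<in> carrier_mat m n" and cC [simp]: "C \<in> carrier_mat m n"
    using B C by (simp_all add: is_pinv_def n_def m_def)
  have [simp]: "A * B \<in> carrier_mat n n" "A * C \<in> carrier_mat n n"
    "B * A \<in> carrier_mat m m" "C * A \<in> carrier_mat m m"
    by (simp_all add: mult_carrier_mat[OF cA cB] mult_carrier_mat[OF cA cC]
        mult_carrier_mat[OF cB cA] mult_carrier_mat[OF cC cA])
  have ABA: "A * B * A = A" and ACA: "A * C * A = A"
    and BAB: "B * A * B = B" and CAC: "C * A * C = C"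
    and tAB: "transpose_mat (A * B) = A * B" and tAC: "transpose_mat (A * C) = A * C"
    and tBA: "transpose_mat (B * A) = B * A" and tCA: "transpose_mat (C * A) = C * A"
    using B C by (simp_all add: is_pinv_def)
  have "A * B = transpose_mat ((A * C) * (A * B))"
    using ACA tAB assoc_mult_mat[of "A * C" n n A m B n] by simp
  also have "\<dots> = (A * B) * (A * C)"
    using transpose_mult[of "A * C" n n "A * B" n] tAB tAC by simp
  also have "\<dots> = A * C"
    using ABA assoc_mult_mat[of "A * B" n n A m C n] by simp
  finally have AB: "A * B = A * C" .
  have "B * A = transpose_mat ((B * A) * (C * A))"
    using ACA tBA assoc_mult_mat[of B m n A m "C * A" m] assoc_mult_mat[of A n m C n A m] by simp
  also have "\<dots> = (C * A) * (B * A)"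
    using transpose_mult[of "B * A" m m "C * A" m] tBA tCA by simp
  also have "\<dots> = C * A"
    using ABA assoc_mult_mat[of C m n A m "B * A" m] assoc_mult_mat[of A n m B n A m] by simp
  finally have BA: "B * A = C * A" .
  have "B = B * (A * B)" using BAB assoc_mult_mat[of B m n A m B n] by simp
  also have "\<dots> = C * A * C" using AB BA assoc_mult_mat[of B m n A m C n] by simp
  finally show ?thesis using CAC by simp
qed

text \<open>Orthonormalising the columns of \<open>A\<close> as \<open>Q = A Y\<close> makes \<open>Q Q\<^sup>T = A (Y Q\<^sup>T)\<close> the orthogonal
  projection onto the column space.\<close>

lemma ex_least_squares_inverse:
  fixes A :: "real mat"
  assumes A: "A \<in> carrier_mat n m"
  obtains G where "G \<in> carrier_mat m n" "A * G * A = A" "transpose_mat (A * G) = A * G"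
proof -
  define B :: "(nat \<Rightarrow> real) \<Rightarrow> (nat \<Rightarrow> real) \<Rightarrow> real" where "B = (\<lambda>u v. \<Sum>x<n. u x * v x)"
  interpret psd_form B
    by unfold_locales
      (auto simp: B_def mult.commute distrib_left sum.distrib sum_distrib_left mult.assoc
        mult.left_commute intro!: sum_nonneg)
  define w where "w = (\<lambda>i x. A $$ (x, i))"
  obtain q Y where Y: "\<And>a. a < m \<Longrightarrow> q a = (\<lambda>x. \<Sum>i<m. Y a i * w i x)"
    and q: "contractive_system q m"
    and res: "\<And>i. i < m \<Longrightarrow> residual q m (w i) (w i) = 0"
    using gram_schmidt[of m w] by blast
  have w_eq: "w i x = (\<Sum>a<m. B (w i) (q a) * q a x)" if "i < m" "x < n" for i x
  proof -
    \<comment> \<open>Pairing with a unit vector reads off the coordinate \<open>x\<close>, so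
      vanishing of the residual form becomes a pointwise identity.\<close>
    define d :: "nat \<Rightarrow> real" where "d = (\<lambda>y. if y = x then 1 else 0)"
    have d: "B v d = v x" for v using that(2) by (simp add: B_def d_def if_distrib cong: if_cong)
    have "residual q m (w i) d = 0" by (rule residual_null[OF q res[OF that(1)]])
    then show ?thesis by (simp add: residual_def d sym[of d])
  qed
  define G where "G = Matrix.mat m n (\<lambda>(i, y). \<Sum>a<m. Y a i * q a y)"
  have G: "G \<in> carrier_mat m n" by (simp add: G_def)
  have AG: "(A * G) $$ (x, y) = (\<Sum>a<m. q a x * q a y)" if "x < n" "y < n" for x y
  proof -
    have "(A * G) $$ (x, y) = (\<Sum>i<m. \<Sum>a<m. w i x * (Y a i * q a y))"
      unfolding mult_mat_entry[OF A G that]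
      by (rule sum.cong) (use that in \<open>auto simp: G_def w_def sum_distrib_left\<close>)
    also have "\<dots> = (\<Sum>a<m. (\<Sum>i<m. Y a i * w i x) * q a y)"
      by (subst sum.swap) (simp add: sum_distrib_left sum_distrib_right algebra_simps)
    also have "\<dots> = (\<Sum>a<m. q a x * q a y)"
      by (rule sum.cong) (auto simp: Y)
    finally show ?thesis .
  qed
  have "A * G * A = A"
  proof (rule eq_matI)
    fix x j assume "x < dim_row A" "j < dim_col A"
    then have xj: "x < n" "j < m" using A by auto
    have "(A * G * A) $$ (x, j) = (\<Sum>y<n. \<Sum>a<m. q a x * q a y * w j y)"
      unfolding mult_mat_entry[OF mult_carrier_mat[OF A G] A xj]
      by (rule sum.cong) (use xj in \<open>auto simp: AG w_def sum_distrib_right\<close>)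
    also have "\<dots> = (\<Sum>a<m. B (w j) (q a) * q a x)"
      by (subst sum.swap) (simp add: B_def sum_distrib_left sum_distrib_right algebra_simps)
    finally show "(A * G * A) $$ (x, j) = A $$ (x, j)"
      using w_eq[OF xj(2,1)] by (simp add: w_def)
  qed (use A G in auto)
  moreover have "transpose_mat (A * G) = A * G"
    by (rule eq_matI) (use A G in \<open>auto simp: AG mult.commute simp del: index_mult_mat(1)\<close>)
  ultimately show ?thesis using that G by blast
qed

text \<open>A least squares inverse \<open>G\<close> makes \<open>A * G\<close> symmetric; the
  transpose \<open>E\<close> of one for the transpose of \<open>A\<close> makes \<open>E * A\<close>
  symmetric. The product \<open>E * A * G\<close> inherits both, since
  \<open>A * (E * A * G) = A * G\<close> and \<open>E * A * G * A = E * A\<close>.\<close>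

lemma ex_is_pinv: "\<exists>B. is_pinv A B"
proof -
  define n m where "n = dim_row A" and "m = dim_col A"
  have A [simp]: "A \<in> carrier_mat n m" by (simp add: n_def m_def)
  obtain G where G [simp]: "G \<in> carrier_mat m n" and AGA: "A * G * A = A"
    and tAG: "transpose_mat (A * G) = A * G"
    using ex_least_squares_inverse[OF A] .
  obtain F where F: "F \<in> carrier_mat n m" and AFA: "transpose_mat A * F * transpose_mat A = transpose_mat A"
    and tAF: "transpose_mat (transpose_mat A * F) = transpose_mat A * F"
    using ex_least_squares_inverse[of "transpose_mat A" m n] by auto
  define E where "E = transpose_mat F"
  have E [simp]: "E \<in> carrier_mat m n" using F by (simp add: E_def)
  have [simp]: "E * A \<in> carrier_mat m m" by (rule mult_carrier_mat[OF E A])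
  have EA: "transpose_mat A * F = E * A"
    using tAF transpose_mult[of "transpose_mat A" m n F m] F by (simp add: E_def)
  have tEA: "transpose_mat (E * A) = E * A" using tAF EA by simp
  have "transpose_mat (E * A * transpose_mat A) = A"
    using AFA EA by simp
  then have AEA: "A * (E * A) = A"
    using transpose_mult[of "E * A" m m "transpose_mat A" n] tEA by simp
  have AEAG: "A * (E * A * G) = A * G"
    using AEA assoc_mult_mat[of A n m "E * A" m G n] by simp
  have EAGA: "E * A * G * A = E * A"
    using AGA assoc_mult_mat[of E m n A m G n] assoc_mult_mat[of E m n "A * G" n A m] by simp
  have "is_pinv A (E * A * G)"
    unfolding is_pinv_def
  proof (intro conjI)
    show "E * A * G \<in> carrier_mat (dim_col A) (dim_row A)"
      using A E G unfolding n_def m_def by (meson mult_carrier_mat)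
    show "A * (E * A * G) * A = A" using AEAG AGA by simp
    show "E * A * G * A * (E * A * G) = E * A * G"
      using EAGA AEA assoc_mult_mat[of "E * A" m m "E * A" m G n] assoc_mult_mat[of E m n A m "E * A" m]
      by simp
    show "transpose_mat (A * (E * A * G)) = A * (E * A * G)" using AEAG tAG by simp
    show "transpose_mat (E * A * G * A) = E * A * G * A" using EAGA tEA by simp
  qed
  then show ?thesis ..
qed

lemma is_pinv_pinv: "is_pinv A (pinv A)"
  unfolding pinv_def using ex_is_pinv is_pinv_unique by (metis theI)

lemma pinv_carrier: "A \<in> carrier_mat n m \<Longrightarrow> pinv A \<in> carrier_mat m n"
  using is_pinv_pinv[of A] by (auto simp: is_pinv_def)

text \<open>Transposing the Penrose conditions shows that the transpose of \<open>pinv A\<close>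
  satisfies them for the transpose of \<open>A\<close>, which is \<open>A\<close>; uniqueness does
  the rest.\<close>

lemma transpose_pinv_symmetric:
  assumes A: "A \<in> carrier_mat n n" and sym: "transpose_mat A = A"
  shows "transpose_mat (pinv A) = pinv A"
proof (rule is_pinv_unique)
  let ?B = "pinv A"
  have B: "?B \<in> carrier_mat n n" by (rule pinv_carrier[OF A])
  have p: "A * ?B * A = A" "?B * A * ?B = ?B"
    "transpose_mat (A * ?B) = A * ?B" "transpose_mat (?B * A) = ?B * A"
    using is_pinv_pinv[of A] by (simp_all add: is_pinv_def)
  have t1: "transpose_mat (A * ?B) = transpose_mat ?B * A"
    and t2: "transpose_mat (?B * A) = A * transpose_mat ?B"
    using transpose_mult[OF A B] transpose_mult[OF B A] sym by simp_all
  have "transpose_mat (A * ?B * A) = A * (transpose_mat ?B * A)"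
    using transpose_mult[of "A * ?B" n n A n] A B t1 sym by simp
  moreover have "transpose_mat (?B * A * ?B) = transpose_mat ?B * (A * transpose_mat ?B)"
    using transpose_mult[of "?B * A" n n ?B n] A B t2 by simp
  ultimately show "is_pinv A (transpose_mat ?B)"
    unfolding is_pinv_def using A B p sym t1 t2
      assoc_mult_mat[of A n n "transpose_mat ?B" n A n]
      assoc_mult_mat[of "transpose_mat ?B" n n A n "transpose_mat ?B" n]
    by auto
qed (rule is_pinv_pinv)

section \<open>Matrix forms and the modes of a decomposition\<close>

text \<open>Arguments are coefficient functions rather than vectors, the shape that
  \<open>psd_form\<close> requires.\<close>

definition mat_form :: "real mat \<Rightarrow> (nat \<Rightarrow> real) \<Rightarrow> (nat \<Rightarrow> real) \<Rightarrow> real" where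
  "mat_form W u v = (\<Sum>a<dim_row W. \<Sum>b<dim_col W. u a * W $$ (a, b) * v b)"

lemma mat_form_eq:
  "W \<in> carrier_mat n m \<Longrightarrow> mat_form W u v = (\<Sum>a<n. \<Sum>b<m. u a * W $$ (a, b) * v b)"
  by (simp add: mat_form_def)

lemma mat_form_scalar_prod:
  "W \<in> carrier_mat n m \<Longrightarrow> mat_form W u v = Matrix.vec n u \<bullet> (W *\<^sub>v Matrix.vec m v)"
  by (simp add: mat_form_eq scalar_prod_def atLeast0LessThan sum_distrib_left mult.assoc)

lemma mat_form_sym:
  assumes W: "W \<in> carrier_mat n n" and sym: "transpose_mat W = W"
  shows "mat_form W u v = mat_form W v u"
proof -
  have "W $$ (a, b) = W $$ (b, a)" if "a < n" "b < n" for a b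
    using sym W that by (metis carrier_matD index_transpose_mat(1))
  then show ?thesis
    unfolding mat_form_eq[OF W] by (subst sum.swap) (simp add: mult.assoc mult.left_commute mult.commute)
qed

lemma psd_form_mat_form:
  assumes "W \<in> carrier_mat n n" "transpose_mat W = W" "\<And>u. 0 \<le> mat_form W u u"
  shows "psd_form (mat_form W)"
proof
  show "mat_form W u v = mat_form W v u" for u v by (rule mat_form_sym[OF assms(1,2)])
  show "mat_form W (\<lambda>x. u x + v x) w = mat_form W u w + mat_form W v w" for u v w
    by (simp add: mat_form_def distrib_right sum.distrib)
  show "mat_form W (\<lambda>x. c * u x) w = c * mat_form W u w" for c u w
    by (simp add: mat_form_def sum_distrib_left mult.assoc)
qed (rule assms(3))

text \<open>With \<open>B = pinv A\<close> symmetric and \<open>c = B r\<close>, the first value is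
  the form of \<open>B * A * B = B\<close> at \<open>r\<close>. This carries nonnegativity over from
  \<open>A\<close> to \<open>pinv A\<close> and evaluates the completed square in the Mercer
  estimate.\<close>

lemma mat_form_pinv:
  assumes A: "A \<in> carrier_mat n n" "transpose_mat A = A"
    and c: "c = (\<lambda>a. \<Sum>b<n. pinv A $$ (a, b) * r b)"
  shows "mat_form A c c = mat_form (pinv A) r r"
    and "(\<Sum>a<n. c a * r a) = mat_form (pinv A) r r"
proof -
  let ?B = "pinv A" and ?r = "Matrix.vec n r"
  have B: "?B \<in> carrier_mat n n" by (rule pinv_carrier[OF A(1)])
  have c': "Matrix.vec n c = ?B *\<^sub>v ?r"
    by (rule eq_vecI) (use B in \<open>auto simp: c scalar_prod_def atLeast0LessThan\<close>)
  have "mat_form A c c = (?B *\<^sub>v ?r) \<bullet> (A *\<^sub>v (?B *\<^sub>v ?r))"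
    by (simp add: mat_form_scalar_prod[OF A(1)] c')
  also have "\<dots> = ?r \<bullet> (?B *\<^sub>v (A *\<^sub>v (?B *\<^sub>v ?r)))"
    using transpose_vec_mult_scalar[OF B, of "A *\<^sub>v (?B *\<^sub>v ?r)" ?r]
      transpose_pinv_symmetric[OF A] mult_mat_vec_carrier[OF A(1) mult_mat_vec_carrier[OF B]]
    by simp
  also have "?B *\<^sub>v (A *\<^sub>v (?B *\<^sub>v ?r)) = (?B * A * ?B) *\<^sub>v ?r"
    using A(1) B by (simp add: assoc_mult_mat_vec[of _ n n _ n])
  also have "?B * A * ?B = ?B" using is_pinv_pinv[of A] by (simp add: is_pinv_def)
  finally show "mat_form A c c = mat_form ?B r r"
    by (simp add: mat_form_scalar_prod[OF B])
  show "(\<Sum>a<n. c a * r a) = mat_form ?B r r"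
    by (simp add: mat_form_eq[OF B] c sum_distrib_left mult_ac)
qed

lemma psd_form_pinv:
  assumes A: "A \<in> carrier_mat n n" "transpose_mat A = A" and psd: "\<And>u. 0 \<le> mat_form A u u"
  shows "psd_form (mat_form (pinv A))"
proof (rule psd_form_mat_form)
  show "0 \<le> mat_form (pinv A) u u" for u
    unfolding mat_form_pinv(1)[OF A refl, of u, symmetric] by (rule psd)
qed (use pinv_carrier[OF A(1)] transpose_pinv_symmetric[OF A] in auto)

text \<open>Both sums are linear in the second moment matrix: the first with coefficients
  \<open>W\<close>, the second with \<open>y a * y b\<close>, where \<open>y\<close> represents the
  functional \<open>mat_form W u\<close>. This is what exchanges sample vectors for modes.\<close>

lemma mat_form_second_moment:
  assumes W: "W \<in> carrier_mat n n"
    and eq: "\<And>a b. a < n \<Longrightarrow> b < n \<Longrightarrow>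
      (\<Sum>i\<in>I. p i a * p i b) = t * (\<Sum>j\<in>J. g j a * g j b)"
  shows "(\<Sum>i\<in>I. mat_form W (p i) (p i)) = t * (\<Sum>j\<in>J. mat_form W (g j) (g j))"
    and "(\<Sum>i\<in>I. (mat_form W u (p i))\<^sup>2) = t * (\<Sum>j\<in>J. (mat_form W u (g j))\<^sup>2)"
proof -
  have swap: "(\<Sum>i\<in>K. \<Sum>a<n. \<Sum>b<n. C a b * (f i a * f i b)) =
      (\<Sum>a<n. \<Sum>b<n. C a b * (\<Sum>i\<in>K. f i a * f i b))"
    for C :: "nat \<Rightarrow> nat \<Rightarrow> real" and K :: "'c set" and f :: "'c \<Rightarrow> nat \<Rightarrow> real"
    by (subst sum.swap, rule sum.cong[OF refl], subst sum.swap) (simp add: sum_distrib_left)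
  have transfer: "(\<Sum>i\<in>I. \<Sum>a<n. \<Sum>b<n. C a b * (p i a * p i b)) =
      t * (\<Sum>j\<in>J. \<Sum>a<n. \<Sum>b<n. C a b * (g j a * g j b))" for C
    unfolding swap by (simp add: eq sum_distrib_left mult.left_commute)
  have 1: "mat_form W v v = (\<Sum>a<n. \<Sum>b<n. W $$ (a, b) * (v a * v b))" for v
    by (simp add: mat_form_eq[OF W] mult_ac)
  show "(\<Sum>i\<in>I. mat_form W (p i) (p i)) = t * (\<Sum>j\<in>J. mat_form W (g j) (g j))"
    unfolding 1 by (rule transfer)
  define y where "y = (\<lambda>b. \<Sum>a<n. u a * W $$ (a, b))"
  have "mat_form W u v = (\<Sum>b<n. y b * v b)" for v
    unfolding mat_form_eq[OF W] y_def by (subst sum.swap) (simp add: sum_distrib_right)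
  then have 2: "(mat_form W u v)\<^sup>2 = (\<Sum>a<n. \<Sum>b<n. (y a * y b) * (v a * v b))" for v
    by (simp add: power2_eq_square sum_product mult_ac)
  show "(\<Sum>i\<in>I. (mat_form W u (p i))\<^sup>2) = t * (\<Sum>j\<in>J. (mat_form W u (g j))\<^sup>2)"
    unfolding 2 by (rule transfer)
qed

section \<open>The modes of a decomposition and the mean squares of its features\<close>

lemma mult_mat_transpose_entry:
  assumes W: "W \<in> carrier_mat n n" and P: "P \<in> carrier_mat m n" and "i < m" "j < m"
  shows "(P * W * transpose_mat P) $$ (i, j) = mat_form W (\<lambda>a. P $$ (i, a)) (\<lambda>b. P $$ (j, b))"
proof -
  have tP: "transpose_mat P \<in> carrier_mat n m" using P by simp
  have "(P * W * transpose_mat P) $$ (i, j) = (\<Sum>b<n. \<Sum>a<n. P $$ (i, a) * W $$ (a, b) * P $$ (j, b))"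
    unfolding mult_mat_entry[OF mult_carrier_mat[OF P W] tP assms(3,4)]
    by (rule sum.cong)
      (use assms in \<open>auto simp: mult_mat_entry[OF P W] sum_distrib_right simp del: index_mult_mat(1)\<close>)
  then show ?thesis by (subst (asm) sum.swap) (simp add: mat_form_eq[OF W])
qed

lemma mat_diag_entry: "i < n \<Longrightarrow> j < n \<Longrightarrow> mat_diag n f $$ (i, j) = (if i = j then f i else 0)"
  by (auto simp: mat_diag_def)

text \<open>The modes are the rows of \<open>P\<close>, the transpose of \<open>V\<close> times
  \<open>H\<close>. Orthogonality of \<open>V\<close> from one side reduces
  \<open>P * W * transpose_mat P\<close> to the diagonal matrix, from the other side it reduces
  \<open>transpose_mat P * P\<close> to \<open>transpose_mat H * H\<close>.\<close>

lemma nystrom_decomposition_modes: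
  assumes dec: "nystrom_decomposition k Z X H V \<kappa>" and l: "l = length Z"
  obtains p where
    "\<And>i j. i < l \<Longrightarrow> j < l \<Longrightarrow>
      mat_form (pinv (kernel_mat k Z Z)) (p i) (p j) = (if i = j then \<kappa> i else 0)"
    "\<And>a b. a < l \<Longrightarrow> b < l \<Longrightarrow> (\<Sum>i<l. p i a * p i b) = h_kernel k X (Z ! a) (Z ! b)"
proof -
  let ?K = "kernel_mat k Z Z" and ?W = "pinv (kernel_mat k Z Z)" and ?D = "mat_diag l \<kappa>"
  have K: "?K \<in> carrier_mat l l" by (simp add: kernel_mat_def l)
  have W: "?W \<in> carrier_mat l l" by (rule pinv_carrier[OF K])
  have H: "H \<in> carrier_mat l l" and HH: "transpose_mat H * H = kernel_mat (h_kernel k X) Z Z"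
    and V: "V \<in> carrier_mat l l" and V1: "transpose_mat V * V = 1\<^sub>m l" and V2: "V * transpose_mat V = 1\<^sub>m l"
    and HWH: "H * ?W * transpose_mat H = V * ?D * transpose_mat V"
    using dec by (simp_all add: nystrom_decomposition_def Let_def l)
  have D: "?D \<in> carrier_mat l l" by simp
  have tV: "transpose_mat V \<in> carrier_mat l l" and tH: "transpose_mat H \<in> carrier_mat l l"
    using V H by simp_all
  note mc = mult_carrier_mat[of _ l l _ l]
  note as = assoc_mult_mat[of _ l l _ l _ l]
  define P where "P = transpose_mat V * H"
  have P: "P \<in> carrier_mat l l" using tV H by (simp add: P_def)
  have tP: "transpose_mat P = transpose_mat H * V"
    using transpose_mult[OF tV H] by (simp add: P_def)
  have "P * ?W * transpose_mat P = transpose_mat V * (H * ?W * transpose_mat H) * V"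
    unfolding tP unfolding P_def using tV tH H V W by (simp add: as mc)
  also have "\<dots> = (transpose_mat V * V) * ?D * (transpose_mat V * V)"
    unfolding HWH using tV V D by (simp add: as mc del: V1)
  also have "\<dots> = ?D"
    using left_mult_one_mat[OF D] right_mult_one_mat[OF D] by (simp add: V1)
  finally have PWP: "P * ?W * transpose_mat P = ?D" .
  have "transpose_mat P * P = transpose_mat H * (V * transpose_mat V) * H"
    unfolding tP unfolding P_def using tV tH H V by (simp add: as mc)
  then have PP: "transpose_mat P * P = kernel_mat (h_kernel k X) Z Z"
    using tH HH by (simp add: V2)
  show ?thesis
  proof (rule that[of "\<lambda>i a. P $$ (i, a)"])
    show "mat_form ?W (\<lambda>a. P $$ (i, a)) (\<lambda>a. P $$ (j, a)) = (if i = j then \<kappa> i else 0)"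
      if "i < l" "j < l" for i j
      unfolding mult_mat_transpose_entry[OF W P that, symmetric] PWP
      by (rule mat_diag_entry[OF that])
    show "(\<Sum>i<l. P $$ (i, a) * P $$ (i, b)) = h_kernel k X (Z ! a) (Z ! b)"
      if "a < l" "b < l" for a b
    proof -
      have "(transpose_mat P * P) $$ (a, b) = (\<Sum>i<l. P $$ (i, a) * P $$ (i, b))"
        using that P by (simp add: mult_mat_entry[of _ l l _ l] del: index_mult_mat(1))
      then show ?thesis using that l by (simp add: PP kernel_mat_def)
    qed
  qed
qed

text \<open>With \<open>g = pinv H *\<^sub>v col V i\<close> the mean square is the squared length
  of \<open>H g\<close>. If \<open>\<kappa> i\<close> is nonzero, the eigenvector lies in the range
  of \<open>H\<close>, so \<open>H g\<close> is that unit vector. The factor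
  \<open>\<kappa> i\<close> on both sides covers the eigenvalue 0, where the eigenvector may lie
  outside the range.\<close>

lemma nystrom_feature_mean_square:
  assumes dec: "nystrom_decomposition k Z X H V \<kappa>"
    and sym: "\<And>x y. k x y = k y x" and i: "i < length Z"
  shows "\<kappa> i * (1 / real (length X) * (\<Sum>j<length X. (nystrom_feature k Z H V i (X ! j))\<^sup>2)) = \<kappa> i"
proof -
  define l where "l = length Z"
  let ?K = "kernel_mat k Z Z" and ?W = "pinv (kernel_mat k Z Z)" and ?D = "mat_diag l \<kappa>"
  let ?v = "col V i"
  have K: "?K \<in> carrier_mat l l" by (simp add: kernel_mat_def l_def)
  have W: "?W \<in> carrier_mat l l" by (rule pinv_carrier[OF K])
  have H: "H \<in> carrier_mat l l" and HH: "transpose_mat H * H = kernel_mat (h_kernel k X) Z Z"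
    and V: "V \<in> carrier_mat l l" and V1: "transpose_mat V * V = 1\<^sub>m l"
    and HWH: "H * ?W * transpose_mat H = V * ?D * transpose_mat V"
    using dec by (simp_all add: nystrom_decomposition_def Let_def l_def)
  have pH: "pinv H \<in> carrier_mat l l" by (rule pinv_carrier[OF H])
  have v: "?v \<in> carrier_vec l" using V by (rule col_carrier_vec[rotated]) (use i in \<open>simp add: l_def\<close>)
  define g where "g = pinv H *\<^sub>v ?v"
  have g: "g \<in> carrier_vec l" using pH v by (simp add: g_def)
  have VD: "H * ?W * transpose_mat H * V = V * ?D"
    unfolding HWH using V V1 right_mult_one_mat[of ?D l l] by (simp add: assoc_mult_mat[of _ l l _ l _ l] mult_carrier_mat[of _ l l _ l])
  have VDi: "col (V * ?D) i = \<kappa> i \<cdot>\<^sub>v ?v"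
  proof (rule eq_vecI)
    fix a assume "a < dim_vec (\<kappa> i \<cdot>\<^sub>v ?v)"
    then have a: "a < l" using V by simp
    have "(V * ?D) $$ (a, i) = (\<Sum>b<l. V $$ (a, b) * (if b = i then \<kappa> i else 0))"
      unfolding mult_mat_entry[OF V mat_diag_dim a i[folded l_def]]
      by (rule sum.cong) (use i l_def in \<open>auto simp: mat_diag_entry\<close>)
    also have "\<dots> = V $$ (a, i) * \<kappa> i" using i by (simp add: l_def if_distrib cong: if_cong)
    finally show "vec_index (col (V * ?D) i) a = vec_index (\<kappa> i \<cdot>\<^sub>v ?v) a"
      using a i V carrier_matD[OF mult_carrier_mat[OF V mat_diag_dim, of \<kappa>]]
      by (simp add: l_def del: index_mult_mat)
  qed (use V in auto)
  \<comment> \<open>\<open>H * R = V * ?D\<close> exhibits the scaled eigenvectors as elements of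
    the range of \<open>H\<close>, which the projection \<open>H * pinv H\<close> fixes.\<close>
  define R where "R = ?W * transpose_mat H * V"
  have R: "R \<in> carrier_mat l l" using W H V by (simp add: R_def mult_carrier_mat[of _ l l _ l])
  have HR: "H * R = V * ?D"
    unfolding VD[symmetric] R_def using W H V
    by (simp add: assoc_mult_mat[of _ l l _ l _ l] mult_carrier_mat[of _ l l _ l])
  have "H * pinv H * (H * R) = H * R"
    using is_pinv_pinv[of H] R H pH assoc_mult_mat[of "H * pinv H" l l H l R l]
    by (simp add: is_pinv_def)
  then have "col (H * pinv H * (V * ?D)) i = \<kappa> i \<cdot>\<^sub>v ?v" by (simp add: HR VDi)
  also have "col (H * pinv H * (V * ?D)) i = (H * pinv H) *\<^sub>v (\<kappa> i \<cdot>\<^sub>v ?v)"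
    using col_mult2[OF mult_carrier_mat[OF H pH] mult_carrier_mat[OF V mat_diag_dim], of i \<kappa>] i
    by (simp add: l_def VDi[unfolded l_def])
  also have "\<dots> = \<kappa> i \<cdot>\<^sub>v (H *\<^sub>v g)"
    using H pH v by (simp add: g_def mult_mat_vec[of _ l l] assoc_mult_mat_vec[of _ l l _ l])
  finally have Hg: "\<kappa> i \<cdot>\<^sub>v (H *\<^sub>v g) = \<kappa> i \<cdot>\<^sub>v ?v" .
  have vv: "?v \<bullet> ?v = 1"
  proof -
    have "(transpose_mat V * V) $$ (i, i) = ?v \<bullet> ?v" using V i by (simp add: l_def)
    then show ?thesis using V1 i by (simp add: l_def)
  qed
  have "1 / real (length X) * (\<Sum>j<length X. (nystrom_feature k Z H V i (X ! j))\<^sup>2) =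
      (\<Sum>a<l. \<Sum>b<l. vec_index g a * h_kernel k X (Z ! a) (Z ! b) * vec_index g b)"
  proof -
    have "(nystrom_feature k Z H V i (X ! j))\<^sup>2 =
        (\<Sum>a<l. \<Sum>b<l. vec_index g a * (k (Z ! a) (X ! j) * k (X ! j) (Z ! b)) * vec_index g b)" for j
      by (simp add: nystrom_feature_def g_def[symmetric] scalar_prod_def kernel_vec_def
          atLeast0LessThan l_def[symmetric] power2_eq_square sum_product sym[of "X ! j"] mult_ac)
    then have "(\<Sum>j<length X. (nystrom_feature k Z H V i (X ! j))\<^sup>2) =
        (\<Sum>a<l. \<Sum>b<l. \<Sum>j<length X. vec_index g a * (k (Z ! a) (X ! j) * k (X ! j) (Z ! b)) * vec_index g b)"
      by (simp only:) (subst sum.swap, rule sum.cong[OF refl], rule sum.swap)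
    then show ?thesis
      by (simp add: h_kernel_def sum_distrib_left sum_distrib_right mult_ac)
  qed
  also have "\<dots> = g \<bullet> ((transpose_mat H * H) *\<^sub>v g)"
    using g by (simp add: HH kernel_mat_def scalar_prod_def atLeast0LessThan l_def
        sum_distrib_left mult_ac)
  also have "\<dots> = (H *\<^sub>v g) \<bullet> (H *\<^sub>v g)"
    using transpose_vec_mult_scalar[of "transpose_mat H" l l "H *\<^sub>v g" g] H g
    by (simp add: assoc_mult_mat_vec[of _ l l _ l])
  finally have ms: "1 / real (length X) * (\<Sum>j<length X. (nystrom_feature k Z H V i (X ! j))\<^sup>2) =
      (H *\<^sub>v g) \<bullet> (H *\<^sub>v g)" .
  show ?thesis
  proof (cases "\<kappa> i = 0")
    case False
    have "H *\<^sub>v g = (1 / \<kappa> i) \<cdot>\<^sub>v (\<kappa> i \<cdot>\<^sub>v (H *\<^sub>v g))" using False by (simp add: smult_smult_assoc)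
    also have "\<dots> = ?v" unfolding Hg using False by (simp add: smult_smult_assoc)
    finally show ?thesis using vv by (simp only: ms)
  qed simp
qed

section \<open>Nystrom kernels and Mercer remainders\<close>

lemma kernel_mat_carrier: "kernel_mat k Z Z \<in> carrier_mat (length Z) (length Z)"
  by (simp add: kernel_mat_def)

lemma transpose_kernel_mat:
  assumes "pd_kernel k"
  shows "transpose_mat (kernel_mat k Z Z) = kernel_mat k Z Z"
  by (rule eq_matI) (use assms in \<open>auto simp: kernel_mat_def pd_kernel_def\<close>)

lemma mat_form_kernel_mat:
  "mat_form (kernel_mat k Z Z) u v =
     (\<Sum>a<length Z. \<Sum>b<length Z. u a * k (Z ! a) (Z ! b) * v b)"
  unfolding mat_form_eq[OF kernel_mat_carrier] by (simp add: kernel_mat_def)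

lemma psd_form_nystrom:
  assumes "pd_kernel k"
  shows "psd_form (mat_form (pinv (kernel_mat k Z Z)))"
proof (rule psd_form_pinv[OF kernel_mat_carrier transpose_kernel_mat[OF assms]])
  fix u :: "nat \<Rightarrow> real"
  have "0 \<le> (\<Sum>a<length Z. \<Sum>b<length Z. u a * u b * k (Z ! a) (Z ! b))"
    using assms by (simp add: pd_kernel_def)
  then show "0 \<le> mat_form (kernel_mat k Z Z) u u"
    by (simp add: mat_form_kernel_mat mult_ac)
qed

lemma nystrom_kernel_eq_mat_form:
  "nystrom_kernel k Z x y =
     mat_form (pinv (kernel_mat k Z Z)) (\<lambda>a. k (Z ! a) x) (\<lambda>a. k (Z ! a) y)"
  by (simp add: nystrom_kernel_def kernel_vec_def
      mat_form_scalar_prod[OF pinv_carrier[OF kernel_mat_carrier]])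

text \<open>Exchanging moments turns the sample mean of the Nystrom kernel into the sum of all
  \<open>\<kappa> i\<close>, and the mean residual of \<open>q\<close> into that sum minus the
  amount captured by \<open>q\<close>. The last two conclusions are then the two halves of Ky Fan's
  principle.\<close>

lemma
  assumes dec: "nystrom_decomposition k Z X H V \<kappa>" and pd: "pd_kernel k" and s: "s \<le> length Z"
  shows mean_nystrom_minus_truncated:
      "1 / real (length X) * (\<Sum>j<length X. nystrom_kernel k Z (X ! j) (X ! j)
        - truncated_nystrom_kernel k Z H V \<kappa> s (X ! j) (X ! j)) = (\<Sum>i=s..<length Z. \<kappa> i)"
    and mean_projected_minus_truncated:
      "1 / real (length X) * (\<Sum>j<length X. projected_nystrom_kernel k Z H V \<kappa> (X ! j) (X ! j)
        - truncated_nystrom_kernel k Z H V \<kappa> s (X ! j) (X ! j)) = (\<Sum>i=s..<length Z. \<kappa> i)"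
    and tail_le_mean_residual:
      "psd_form.contractive_system (mat_form (pinv (kernel_mat k Z Z))) q s \<Longrightarrow>
       (\<Sum>i=s..<length Z. \<kappa> i) \<le> 1 / real (length X) * (\<Sum>j<length X.
          psd_form.residual (mat_form (pinv (kernel_mat k Z Z))) q s
            (\<lambda>a. k (Z ! a) (X ! j)) (\<lambda>a. k (Z ! a) (X ! j)))"
    and tail_eq_mean_residual:
      "\<exists>q. psd_form.contractive_system (mat_form (pinv (kernel_mat k Z Z))) q s \<and>
       (\<Sum>i=s..<length Z. \<kappa> i) = 1 / real (length X) * (\<Sum>j<length X.
          psd_form.residual (mat_form (pinv (kernel_mat k Z Z))) q s
            (\<lambda>a. k (Z ! a) (X ! j)) (\<lambda>a. k (Z ! a) (X ! j)))"
proof -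
  define l M where "l = length Z" and "M = length X"
  let ?W = "pinv (kernel_mat k Z Z)"
  let ?g = "\<lambda>j a. k (Z ! a) (X ! j)"
  have ksym: "k x y = k y x" for x y using pd by (simp add: pd_kernel_def)
  have W: "?W \<in> carrier_mat l l" unfolding l_def by (rule pinv_carrier[OF kernel_mat_carrier])
  interpret psd_form "mat_form ?W" by (rule psd_form_nystrom[OF pd])
  obtain p where p: "\<And>i j. i < l \<Longrightarrow> j < l \<Longrightarrow> mat_form ?W (p i) (p j) = (if i = j then \<kappa> i else 0)"
    and pp: "\<And>a b. a < l \<Longrightarrow> b < l \<Longrightarrow> (\<Sum>i<l. p i a * p i b) = h_kernel k X (Z ! a) (Z ! b)"
    using nystrom_decomposition_modes[OF dec l_def] by blast
  have moment: "(\<Sum>i<l. p i a * p i b) = 1 / real M * (\<Sum>j<M. ?g j a * ?g j b)" if "a < l" "b < l" for a b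
    unfolding pp[OF that] h_kernel_def M_def by (simp add: ksym[of "X ! _"])
  have split: "(\<Sum>i<l. \<kappa> i) = (\<Sum>i<s. \<kappa> i) + (\<Sum>i=s..<l. \<kappa> i)"
    using s sum.atLeastLessThan_concat[of 0 s l \<kappa>] by (simp add: atLeast0LessThan l_def)
  have trace: "1 / real M * (\<Sum>j<M. mat_form ?W (?g j) (?g j)) = (\<Sum>i<l. \<kappa> i)"
  proof -
    have "(\<Sum>i<l. mat_form ?W (p i) (p i)) = 1 / real M * (\<Sum>j<M. mat_form ?W (?g j) (?g j))"
      by (rule mat_form_second_moment(1)[OF W moment])
    then show ?thesis using p by simp
  qed
  have features: "1 / real M * (\<Sum>j<M. \<Sum>i<n. \<kappa> i * nystrom_feature k Z H V i (X ! j) *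
      nystrom_feature k Z H V i (X ! j)) = (\<Sum>i<n. \<kappa> i)" if "n \<le> l" for n
  proof -
    have "1 / real M * (\<Sum>j<M. \<Sum>i<n. \<kappa> i * nystrom_feature k Z H V i (X ! j) *
        nystrom_feature k Z H V i (X ! j)) =
        (\<Sum>i<n. \<kappa> i * (1 / real M * (\<Sum>j<M. (nystrom_feature k Z H V i (X ! j))\<^sup>2)))"
      by (subst sum.swap) (simp add: sum_distrib_left power2_eq_square mult_ac)
    also have "\<dots> = (\<Sum>i<n. \<kappa> i)"
      by (rule sum.cong[OF refl], unfold M_def, rule nystrom_feature_mean_square[OF dec ksym])
        (use that in \<open>simp add: l_def\<close>)
    finally show ?thesis .
  qed
  show "1 / real (length X) * (\<Sum>j<length X. nystrom_kernel k Z (X ! j) (X ! j)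
      - truncated_nystrom_kernel k Z H V \<kappa> s (X ! j) (X ! j)) = (\<Sum>i=s..<length Z. \<kappa> i)"
    unfolding M_def[symmetric] l_def[symmetric] sum_subtractf right_diff_distrib
      nystrom_kernel_eq_mat_form truncated_nystrom_kernel_def trace features[OF s[folded l_def]]
    by (simp add: split)
  show "1 / real (length X) * (\<Sum>j<length X. projected_nystrom_kernel k Z H V \<kappa> (X ! j) (X ! j)
      - truncated_nystrom_kernel k Z H V \<kappa> s (X ! j) (X ! j)) = (\<Sum>i=s..<length Z. \<kappa> i)"
    unfolding M_def[symmetric] l_def[symmetric] sum_subtractf right_diff_distrib
      projected_nystrom_kernel_def truncated_nystrom_kernel_def features[OF s[folded l_def]]
      features[OF order.refl]
    by (simp add: split)
  have residual: "1 / real M * (\<Sum>j<M. residual q s (?g j) (?g j)) =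
      (\<Sum>i<l. \<kappa> i) - (\<Sum>a<s. \<Sum>i<l. (mat_form ?W (q a) (p i))\<^sup>2)" for q
  proof -
    have "(\<Sum>a<s. \<Sum>i<l. (mat_form ?W (q a) (p i))\<^sup>2) =
        (\<Sum>a<s. 1 / real M * (\<Sum>j<M. (mat_form ?W (q a) (?g j))\<^sup>2))"
      by (rule sum.cong[OF refl], rule mat_form_second_moment(2)[OF W moment])
    also have "\<dots> = 1 / real M * (\<Sum>j<M. \<Sum>a<s. (mat_form ?W (?g j) (q a))\<^sup>2)"
      by (subst sum.swap) (simp add: sum_distrib_left sym[of "?g _" "q _"])
    finally show ?thesis
      by (simp only: residual_def trace[symmetric] sum_subtractf right_diff_distrib power2_eq_square)
  qed
  note dec_\<kappa> = dec[unfolded nystrom_decomposition_def Let_def]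
  show "(\<Sum>i=s..<length Z. \<kappa> i) \<le> 1 / real (length X) * (\<Sum>j<length X. residual q s (?g j) (?g j))"
    if "contractive_system q s"
    using ky_fan[of l p \<kappa>, OF p _ that] dec_\<kappa> s residual[of q] split
    by (simp add: l_def M_def)
  obtain q where "contractive_system q s" "(\<Sum>a<s. \<Sum>i<l. (mat_form ?W (q a) (p i))\<^sup>2) = (\<Sum>i<s. \<kappa> i)"
    using ky_fan_attained[of l p \<kappa> s] p s l_def by metis
  then show "\<exists>q. contractive_system q s \<and> (\<Sum>i=s..<length Z. \<kappa> i) =
      1 / real (length X) * (\<Sum>j<length X. residual q s (?g j) (?g j))"
    using residual[of q] split by (intro exI[of _ q]) (simp add: l_def M_def)
qed

text \<open>With \<open>c = W r\<close> and \<open>W = K\<^sup>+\<close>, this is nonnegativity of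
  \<open>\<Sum>i. \<sigma> i * (\<Sum>a. c a * e i (z a) - [i \<ge> s] * e i y)\<^sup>2\<close>.\<close>

lemma mat_form_mercer_remainder_le:
  fixes e :: "nat \<Rightarrow> 'a \<Rightarrow> real"
  assumes pd: "pd_kernel k" and \<sigma>: "\<And>i. 0 \<le> \<sigma> i"
    and mercer: "\<And>y z. (\<lambda>i. \<sigma> i * e i y * e i z) sums k y z"
    and r: "r = (\<lambda>a. k (Z ! a) y - (\<Sum>i<s. \<sigma> i * e i (Z ! a) * e i y))"
  shows "mat_form (pinv (kernel_mat k Z Z)) r r \<le> k y y - (\<Sum>i<s. \<sigma> i * (e i y)\<^sup>2)"
proof -
  define l where "l = length Z"
  let ?K = "kernel_mat k Z Z"
  define c where "c = (\<lambda>a. \<Sum>b<l. pinv ?K $$ (a, b) * r b)"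
  define t where "t = (\<lambda>i. \<Sum>a<l. c a * e i (Z ! a))"
  \<comment> \<open>Zeroing the first \<open>s\<close> entries, instead of shifting the index, lets
    the three series below be added termwise.\<close>
  define d where "d = (\<lambda>i. if i < s then 0 else e i y)"
  have tail: "(\<lambda>i. \<sigma> i * e i z * d i) sums (k z y - (\<Sum>i<s. \<sigma> i * e i z * e i y))" for z
  proof -
    have "(\<lambda>i. \<sigma> i * e i z * e i y - (if i \<in> {..<s} then \<sigma> i * e i z * e i y else 0)) sums
        (k z y - (\<Sum>i<s. \<sigma> i * e i z * e i y))"
      by (intro sums_diff mercer sums_If_finite_set) simp
    then show ?thesis by (rule sums_cong[THEN iffD1, rotated]) (simp add: d_def)
  qed
  have tt: "(\<lambda>i. \<sigma> i * (t i)\<^sup>2) sums mat_form ?K c c"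
  proof -
    have "(\<lambda>i. \<Sum>a<l. \<Sum>b<l. (c a * c b) * (\<sigma> i * e i (Z ! a) * e i (Z ! b))) sums
        (\<Sum>a<l. \<Sum>b<l. (c a * c b) * k (Z ! a) (Z ! b))"
      by (intro sums_sum sums_mult mercer)
    then show ?thesis
      by (simp add: t_def power2_eq_square sum_product sum_distrib_left mat_form_kernel_mat l_def mult_ac)
  qed
  have td: "(\<lambda>i. \<sigma> i * t i * d i) sums (\<Sum>a<l. c a * r a)"
  proof -
    have "(\<lambda>i. \<Sum>a<l. c a * (\<sigma> i * e i (Z ! a) * d i)) sums (\<Sum>a<l. c a * r a)"
      unfolding r by (intro sums_sum sums_mult tail)
    then show ?thesis
      by (simp add: t_def sum_distrib_left sum_distrib_right mult_ac)
  qed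
  have dd: "(\<lambda>i. \<sigma> i * (d i)\<^sup>2) sums (k y y - (\<Sum>i<s. \<sigma> i * (e i y)\<^sup>2))"
  proof -
    have "\<sigma> i * e i y * d i = \<sigma> i * (d i)\<^sup>2" for i by (simp add: d_def power2_eq_square)
    then show ?thesis using tail[of y] by (simp only: power2_eq_square mult.assoc)
  qed
  have "(\<lambda>i. \<sigma> i * (t i)\<^sup>2 - 2 * (\<sigma> i * t i * d i) + \<sigma> i * (d i)\<^sup>2) sums
      (mat_form ?K c c - 2 * (\<Sum>a<l. c a * r a) + (k y y - (\<Sum>i<s. \<sigma> i * (e i y)\<^sup>2)))"
    by (intro sums_add sums_diff sums_mult tt td dd)
  moreover have "0 \<le> \<sigma> i * (t i)\<^sup>2 - 2 * (\<sigma> i * t i * d i) + \<sigma> i * (d i)\<^sup>2" for i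
  proof -
    have "0 \<le> \<sigma> i * (t i - d i)\<^sup>2" using \<sigma> by simp
    then show ?thesis by (simp add: power2_diff algebra_simps)
  qed
  ultimately have "0 \<le> mat_form ?K c c - 2 * (\<Sum>a<l. c a * r a) + (k y y - (\<Sum>i<s. \<sigma> i * (e i y)\<^sup>2))"
    by (metis (no_types, lifting) sums_le sums_zero)
  \<comment> \<open>The quadratic and the cross term are the same number, so after subtracting the
    cross term twice it remains once with a negative sign.\<close>
  moreover have "mat_form ?K c c = mat_form (pinv ?K) r r" "(\<Sum>a<l. c a * r a) = mat_form (pinv ?K) r r"
    using mat_form_pinv[OF kernel_mat_carrier transpose_kernel_mat[OF pd]] c_def l_def by auto
  ultimately show ?thesis by simp
qed

section \<open>Measurability and trace from Mercer's expansion\<close>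

lemma
  fixes e :: "nat \<Rightarrow> 'a \<Rightarrow> real"
  assumes orth: "L2_orthonormal \<mu> e" and \<sigma>: "\<And>i. 0 \<le> \<sigma> i"
    and mercer: "\<And>y z. (\<lambda>i. \<sigma> i * e i y * e i z) sums k y z"
  shows borel_measurable_mercer: "k z \<in> borel_measurable \<mu>"
    and mercer_trace: "integrable \<mu> (\<lambda>y. k y y) \<Longrightarrow> \<sigma> sums (\<integral>y. k y y \<partial>\<mu>)"
proof -
  have e [measurable]: "e i \<in> borel_measurable \<mu>" and e2: "integrable \<mu> (\<lambda>y. (e i y)\<^sup>2)"
    and norm: "(\<integral>y. (e i y)\<^sup>2 \<partial>\<mu>) = 1" for i
    using orth by (auto simp: L2_orthonormal_def L2_functions_def power2_eq_square)
  have lim: "(\<lambda>n. \<Sum>i<n. \<sigma> i * e i y * e i z) \<longlonglongrightarrow> k y z" for y z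
    using mercer by (simp add: sums_def)
  show "k z \<in> borel_measurable \<mu>"
    by (rule borel_measurable_LIMSEQ_real[OF lim]) measurable
  have diag: "(\<lambda>y. k y y) \<in> borel_measurable \<mu>"
    by (rule borel_measurable_LIMSEQ_real[OF lim]) measurable
  assume int: "integrable \<mu> (\<lambda>y. k y y)"
  \<comment> \<open>The diagonal terms are nonnegative, so \<open>k y y\<close> dominates all
    partial sums; each term integrates to \<open>\<sigma> i\<close> because \<open>e i\<close> is
    normalised.\<close>
  have "(\<lambda>n. \<integral>y. (\<Sum>i<n. \<sigma> i * e i y * e i y) \<partial>\<mu>) \<longlonglongrightarrow> (\<integral>y. k y y \<partial>\<mu>)"
  proof (rule integral_dominated_convergence[OF diag _ int])
    show "AE y in \<mu>. norm (\<Sum>i<n. \<sigma> i * e i y * e i y) \<le> k y y" for n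
    proof (rule AE_I2)
      fix y
      have nn: "0 \<le> \<sigma> i * e i y * e i y" for i using \<sigma> by (simp add: mult.assoc)
      then show "norm (\<Sum>i<n. \<sigma> i * e i y * e i y) \<le> k y y"
        using sum_le_suminf[OF sums_summable[OF mercer], of "{..<n}" y y] sums_unique[OF mercer, of y y]
        by (simp add: sum_nonneg)
    qed
  qed (use lim in auto)
  moreover have "(\<integral>y. (\<Sum>i<n. \<sigma> i * e i y * e i y) \<partial>\<mu>) = (\<Sum>i<n. \<sigma> i)" for n
    using e2 norm by (simp add: mult.assoc power2_eq_square)
  ultimately show "\<sigma> sums (\<integral>y. k y y \<partial>\<mu>)" by (simp add: sums_def)
qed

text \<open>As the infimum is attained, \<open>T\<close> is below \<open>b\<close> exactly where
  some \<open>F q\<close> is. The union over \<open>q\<close> may be uncountable, but it is a union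
  of open sets.\<close>

lemma borel_measurable_attained_Inf_continuous:
  fixes T :: "'w \<Rightarrow> real" and y :: "'w \<Rightarrow> 'b::topological_space"
  assumes y: "y \<in> borel_measurable P"
    and cont: "\<And>q. q \<in> Q \<Longrightarrow> continuous_on UNIV (F q)"
    and le: "\<And>\<omega> q. \<omega> \<in> space P \<Longrightarrow> q \<in> Q \<Longrightarrow> T \<omega> \<le> F q (y \<omega>)"
    and attained: "\<And>\<omega>. \<omega> \<in> space P \<Longrightarrow> \<exists>q\<in>Q. T \<omega> = F q (y \<omega>)"
  shows "T \<in> borel_measurable P"
proof (rule borel_measurableI_less)
  fix b
  have "open (\<Union>q\<in>Q. {v. F q v < b})"
    using cont by (intro open_UN ballI open_Collect_less) auto
  then have "y -` (\<Union>q\<in>Q. {v. F q v < b}) \<inter> space P \<in> sets P"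
    by (intro measurable_sets[OF y] borel_open)
  also have "y -` (\<Union>q\<in>Q. {v. F q v < b}) \<inter> space P = {\<omega> \<in> space P. T \<omega> < b}"
    using le attained by (fastforce intro: le_less_trans)
  finally show "{\<omega> \<in> space P. T \<omega> < b} \<in> sets P" .
qed

section \<open>The expectation of the eigenvalue tail over the sample\<close>

theorem proposition4:
  fixes \<mu> :: "'a::t2_space measure"
    and k :: "'a \<Rightarrow> 'a \<Rightarrow> real"
    and Hk :: "('a \<Rightarrow> real) set"
    and ip :: "('a \<Rightarrow> real) \<Rightarrow> ('a \<Rightarrow> real) \<Rightarrow> real"
    and \<sigma> :: "nat \<Rightarrow> real"
    and e :: "nat \<Rightarrow> 'a \<Rightarrow> real"
    and Z :: "'a list"
    and s M :: nat
    and P :: "'w measure"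
    and x :: "nat \<Rightarrow> 'w \<Rightarrow> 'a"
    and H V :: "'w \<Rightarrow> real mat"
    and \<kappa> :: "'w \<Rightarrow> nat \<Rightarrow> real"
  assumes "prob_space \<mu>" and "sets \<mu> = sets borel"
    and "pd_kernel k" and "integrable \<mu> (\<lambda>y. k y y)"
    and "rkhs k Hk ip"
    and "L2_orthonormal \<mu> e"
    and "\<And>i. AE y in \<mu>. integral_operator \<mu> k (e i) y = \<sigma> i * e i y"
    and "\<And>i. 0 \<le> \<sigma> i" and "decseq \<sigma>"
    and "\<And>y z. (\<lambda>i. \<sigma> i * e i y * e i z) sums k y z"
    and "orthonormal_basis_of Hk ip {i. 0 < \<sigma> i} (\<lambda>i y. sqrt (\<sigma> i) * e i y)"
    and "s \<le> length Z" and "1 \<le> M"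
    and "prob_space P"
    and "prob_space.indep_vars P (\<lambda>_. borel) x {..<M}"
    and "\<And>j. j < M \<Longrightarrow> distr P borel (x j) = \<mu>"
    and "\<And>\<omega>. \<omega> \<in> space P \<Longrightarrow>
           nystrom_decomposition k Z (map (\<lambda>j. x j \<omega>) [0..<M]) (H \<omega>) (V \<omega>) (\<kappa> \<omega>)"
  defines "A \<equiv> (\<lambda>\<omega>. (1 / real M) * (\<Sum>j<M. nystrom_kernel k Z (x j \<omega>) (x j \<omega>)
                    - truncated_nystrom_kernel k Z (H \<omega>) (V \<omega>) (\<kappa> \<omega>) s (x j \<omega>) (x j \<omega>)))"
    and "B \<equiv> (\<lambda>\<omega>. (1 / real M) * (\<Sum>j<M. projected_nystrom_kernel k Z (H \<omega>) (V \<omega>) (\<kappa> \<omega>) (x j \<omega>) (x j \<omega>)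
                    - truncated_nystrom_kernel k Z (H \<omega>) (V \<omega>) (\<kappa> \<omega>) s (x j \<omega>) (x j \<omega>)))"
  shows "integrable P A \<and> integrable P B \<and> summable \<sigma> \<and>
         prob_space.expectation P A = prob_space.expectation P B \<and>
         prob_space.expectation P B \<le> (\<Sum>i. \<sigma> (i + s))"
proof -
  interpret P: prob_space P by fact
  let ?W = "pinv (kernel_mat k Z Z)"
  interpret psd_form "mat_form ?W" by (rule psd_form_nystrom) fact
  define l where "l = length Z"
  have W: "?W \<in> carrier_mat l l" unfolding l_def by (rule pinv_carrier[OF kernel_mat_carrier])
  have x [measurable]: "x j \<in> measurable P borel" if "j < M" for j
    using assms(15) that by (auto simp: P.indep_vars_def)
  note mercer = assms(6,8,10)
  have k_meas: "k z \<in> borel_measurable borel" for z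
    using borel_measurable_mercer[OF mercer] assms(2) by (simp cong: measurable_cong_sets)
  define X where "X = (\<lambda>\<omega>. map (\<lambda>j. x j \<omega>) [0..<M])"
  have X: "length (X \<omega>) = M" "j < M \<Longrightarrow> X \<omega> ! j = x j \<omega>" for \<omega> j by (simp_all add: X_def)
  have dec: "nystrom_decomposition k Z (X \<omega>) (H \<omega>) (V \<omega>) (\<kappa> \<omega>)" if "\<omega> \<in> space P" for \<omega>
    unfolding X_def by (rule assms(17)[OF that])
  define T where "T = (\<lambda>\<omega>. \<Sum>i=s..<l. \<kappa> \<omega> i)"
  have A: "A \<omega> = T \<omega>" if "\<omega> \<in> space P" for \<omega>
    using mean_nystrom_minus_truncated[OF dec[OF that] assms(3,12)] by (simp add: A_def T_def l_def X)
  have B: "B \<omega> = T \<omega>" if "\<omega> \<in> space P" for \<omega>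
    using mean_projected_minus_truncated[OF dec[OF that] assms(3,12)] by (simp add: B_def T_def l_def X)
  \<comment> \<open>As a function of the array \<open>v\<close>, this is a polynomial in finitely
    many entries, hence continuous in the product topology.\<close>
  define F where "F = (\<lambda>q v. 1 / real M * (\<Sum>j<M. residual q s (\<lambda>a. v (a, j)) (\<lambda>a. v (a, j))))"
  \<comment> \<open>Measurability is checked at every index pair, but \<open>x j\<close> is known to
    be measurable only for \<open>j < M\<close>; the other entries are set to 0. For
    \<open>a\<close> beyond the length of \<open>Z\<close>, \<open>Z ! a\<close> is still some fixed
    point, to which \<open>k_meas\<close> applies.\<close>
  define y where "y = (\<lambda>\<omega> (a, j). if j < M then k (Z ! a) (x j \<omega>) else 0)"
  have F: "F q (y \<omega>) = 1 / real M * (\<Sum>j<M. residual q s (\<lambda>a. k (Z ! a) (x j \<omega>)) (\<lambda>a. k (Z ! a) (x j \<omega>)))"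
    for q \<omega> by (simp add: F_def y_def)
  have T_le: "T \<omega> \<le> F q (y \<omega>)" if "\<omega> \<in> space P" "contractive_system q s" for \<omega> q
    using tail_le_mean_residual[OF dec[OF that(1)] assms(3,12) that(2)] by (simp add: T_def F X l_def)
  have T_attained: "\<exists>q\<in>{q. contractive_system q s}. T \<omega> = F q (y \<omega>)" if "\<omega> \<in> space P" for \<omega>
    using tail_eq_mean_residual[OF dec[OF that] assms(3,12)] by (simp add: T_def F X l_def)
  have T_meas: "T \<in> borel_measurable P"
  proof (rule borel_measurable_attained_Inf_continuous[where F = F and Q = "{q. contractive_system q s}"])
    show "y \<in> borel_measurable P"
    proof (rule measurable_coordinatewise_then_product)
      fix p :: "nat \<times> nat"
      obtain a j where p: "p = (a, j)" by (cases p)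
      show "(\<lambda>\<omega>. y \<omega> p) \<in> borel_measurable P"
        using measurable_compose[OF x k_meas, of j "Z ! a"] by (cases "j < M") (simp_all add: p y_def)
    qed
    show "continuous_on UNIV (F q)" for q
      unfolding F_def residual_def mat_form_eq[OF W] by (intro continuous_intros) simp_all
  qed (use T_le T_attained in auto)
  have T_nonneg: "0 \<le> T \<omega>" if "\<omega> \<in> space P" for \<omega>
    unfolding T_def using dec[OF that]
    by (intro sum_nonneg) (simp add: nystrom_decomposition_def Let_def l_def)
  define R where "R = (\<lambda>z. k z z - (\<Sum>i<s. \<sigma> i * (e i z)\<^sup>2))"
  have \<sigma>: "\<sigma> sums (\<integral>z. k z z \<partial>\<mu>)" by (rule mercer_trace[OF mercer assms(4)])
  have e2: "integrable \<mu> (\<lambda>z. (e i z)\<^sup>2)" "(\<integral>z. (e i z)\<^sup>2 \<partial>\<mu>) = 1" for i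
    using assms(6) by (auto simp: L2_orthonormal_def L2_functions_def power2_eq_square)
  have R_int: "integrable \<mu> R" unfolding R_def using e2 assms(4) by simp
  have R_eq: "(\<integral>z. R z \<partial>\<mu>) = (\<Sum>i. \<sigma> (i + s))"
    using e2 assms(4) suminf_minus_initial_segment[OF sums_summable[OF \<sigma>], of s] sums_unique[OF \<sigma>]
    by (simp add: R_def)
  have R_meas: "R \<in> borel_measurable borel"
    using borel_measurable_integrable[OF R_int] assms(2) by (simp cong: measurable_cong_sets)
  have Rx_int: "integrable P (\<lambda>\<omega>. R (x j \<omega>))" if "j < M" for j
    by (rule integrable_distr[OF x[OF that]]) (simp add: assms(16)[OF that] R_int)
  have Rx_eq: "(\<integral>\<omega>. R (x j \<omega>) \<partial>P) = (\<Sum>i. \<sigma> (i + s))" if "j < M" for j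
    using integral_distr[OF x[OF that] R_meas] by (simp add: assms(16)[OF that] R_eq)
  \<comment> \<open>This \<open>q\<close> is built from \<open>Z\<close> and the eigenfunctions
    alone, so one system serves for all outcomes and its residual is a fixed function of each sample
    point.\<close>
  obtain q where q: "contractive_system q s"
    and null: "\<And>i. i < s \<Longrightarrow> residual q s (\<lambda>a. e i (Z ! a)) (\<lambda>a. e i (Z ! a)) = 0"
    using gram_schmidt[of s "\<lambda>i a. e i (Z ! a)"] by blast
  have R_bound: "residual q s (\<lambda>a. k (Z ! a) z) (\<lambda>a. k (Z ! a) z) \<le> R z" for z
  proof -
    \<comment> \<open>The Mercer series truncated at \<open>s\<close> supplies an explicit
      competitor in the span of the vectors \<open>e i (Z)\<close>.\<close>
    let ?r = "\<lambda>a. k (Z ! a) z - (\<Sum>i<s. \<sigma> i * e i (Z ! a) * e i z)"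
    have "residual q s (\<lambda>a. k (Z ! a) z) (\<lambda>a. k (Z ! a) z) \<le> mat_form ?W ?r ?r"
      using residual_le_distance[OF q, of "{..<s}" "\<lambda>i a. e i (Z ! a)" "\<lambda>a. k (Z ! a) z"
          "\<lambda>i. \<sigma> i * e i z"] null by (simp add: mult_ac)
    also have "\<dots> \<le> R z"
      unfolding R_def by (rule mat_form_mercer_remainder_le[OF assms(3,8,10) refl])
    finally show ?thesis .
  qed
  \<comment> \<open>Each \<open>x j\<close> has law \<open>\<mu>\<close>, so the expectation of this
    average is that of a single term; \<open>1 \<le> M\<close> is needed to cancel the factor
    \<open>M\<close>.\<close>
  define U where "U = (\<lambda>\<omega>. 1 / real M * (\<Sum>j<M. R (x j \<omega>)))"
  have U_int: "integrable P U" unfolding U_def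
    by (intro integrable_mult_right Bochner_Integration.integrable_sum Rx_int) simp
  have U_eq: "(\<integral>\<omega>. U \<omega> \<partial>P) = (\<Sum>i. \<sigma> (i + s))"
    unfolding U_def using Rx_int Rx_eq \<open>1 \<le> M\<close> by simp
  have T_U: "T \<omega> \<le> U \<omega>" if "\<omega> \<in> space P" for \<omega>
  proof -
    have "F q (y \<omega>) \<le> U \<omega>"
      unfolding F U_def by (intro mult_left_mono sum_mono R_bound) simp
    then show ?thesis using T_le[OF that q] by simp
  qed
  \<comment> \<open>\<open>T\<close> lies between 0 and the integrable \<open>U\<close>.\<close>
  have T_int: "integrable P T"
    by (rule Bochner_Integration.integrable_bound[OF U_int T_meas])
      (use T_nonneg T_U in \<open>auto intro!: AE_I2 order_trans[OF _ abs_ge_self]\<close>)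
  have "(\<integral>\<omega>. T \<omega> \<partial>P) \<le> (\<Sum>i. \<sigma> (i + s))"
    unfolding U_eq[symmetric] by (rule integral_mono[OF T_int U_int T_U])
  moreover have "(\<integral>\<omega>. A \<omega> \<partial>P) = (\<integral>\<omega>. T \<omega> \<partial>P)" "(\<integral>\<omega>. B \<omega> \<partial>P) = (\<integral>\<omega>. T \<omega> \<partial>P)"
    using A B by (auto intro!: Bochner_Integration.integral_cong)
  moreover have "integrable P A" "integrable P B"
    using T_int A B by (simp_all cong: Bochner_Integration.integrable_cong)
  ultimately show ?thesis using sums_summable[OF \<sigma>] by simp
qed

end
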